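(* For each $v\in\mathscr{X}(\Omega,w)$ there exists a unique $\lambda=\lambda(v)\in\mathscr{X}(\Omega,w)'$ such that $$\langle\lambda,\mathrm{Tr}_\Omega\,\psi\rangle_{\mathscr{X}',\mathscr{X}}=(S(v),\psi)_{\mathscr{L}_{0,L}^{1,2}(\mathcal{C},w)}\qquad\text{for all }\psi\in\mathscr{L}_{0,L}^{1,2}(\mathcal{C},w).$$
   Context: Let $\Omega\subset\mathbb{R}^N$, $N\ge 1$, be a non-empty bounded open set (no regularity of $\partial\Omega$ is assumed). Set $\mathcal{C}=\Omega\times(0,\infty)$, $\partial_L\mathcal{C}=\partial\Omega\times[0,\infty)$, $\mathcal{C}_\Omega=\mathcal{C}\cup(\Omega\times\{0\})$; points of $\mathcal{C}$ are written $X=(x,y)$ with $x\in\Omega$, $y>0$. A weight is a measurable function that is positive and finite almost everywhere. Assumptions. $s:\Omega\to\mathbb{R}$ is measurable with $s(x)\in[0,1]$ for almost all $x\in\Omega$. $\mathrm{G}_s:\Omega\to\mathbb{R}$ is a weight with $\mathrm{G}_s^{-1}\in L^1_{\mathrm{loc}}(\Omega)$; if $s(\cdot)=s\in(0,1)$ is constant, then $\mathrm{G}_s(x)=2^{2s-1}\Gamma(s)/\Gamma(1-s)$ for all $x\in\Omega$. The weight $w$ on $\mathcal{C}$ is $w(x,y)=\mathrm{G}_s(x)\,y^{1-2s(x)}$. $L^2(\mathcal{C},w)$ is the space of measurable $f$ with $\|f\|_{L^2(\mathcal{C},w)}=(\int_{\mathcal{C}}|f|^2w\,dX)^{1/2}<\infty$.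 $L^{1,2}(\mathcal{C},w)$ is the set of measurable $u:\mathcal{C}\to\mathbb{R}$ with (weak) gradient $\nabla u\in L^2(\mathcal{C},w)$, with semi-norm $\|u\|_{L^{1,2}(\mathcal{C},w)}=\|\nabla u\|_{L^2(\mathcal{C},w)}$. $C_c^\infty(\mathcal{C}_\Omega)$ is the set of $u\in C^\infty(\overline{\mathcal{C}})$ with compact support in $\mathcal{C}_\Omega$ (in particular the support does not meet $\partial_L\mathcal{C}$; $u$ need not vanish on $\Omega\times\{0\}$). $\mathscr{L}^{1,2}_{0,L}(\mathcal{C},w)$ is the completion of $C_c^\infty(\mathcal{C}_\Omega)\cap L^{1,2}(\mathcal{C},w)$ with respect to $\|\cdot\|_{L^{1,2}(\mathcal{C},w)}$, and $\mathscr{L}^{1,2}_0(\mathcal{C},w)$ is the completion of $C_c^\infty(\mathcal{C})\cap L^{1,2}(\mathcal{C},w)$ with respect to the same norm. Both are Hilbert spaces, with inner product $(\cdot,\cdot)_{\mathscr{L}_{0,L}^{1,2}(\mathcal{C},w)}$ extending $(u_1,u_2)\mapsto\int_{\mathcal{C}}w\,\nabla u_1\cdot\nabla u_2\,dX$ by continuity, and $\mathscr{L}^{1,2}_0(\mathcal{C},w)$ is a closed subspace of $\mathscr{L}^{1,2}_{0,L}(\mathcal{C},w)$. $\mathscr{X}(\Omega,w):=\mathscr{L}_{0,L}^{1,2}(\mathcal{C},w)/\mathscr{L}_0^{1,2}(\mathcal{C},w)$ with the quotient norm (a Hilbert space), $\mathscr{X}(\Omega,w)'$ is its dual space with duality pairing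 $\langle\cdot,\cdot\rangle_{\mathscr{X}',\mathscr{X}}$, and $\mathrm{Tr}_\Omega:\mathscr{L}_{0,L}^{1,2}(\mathcal{C},w)\to\mathscr{X}(\Omega,w)$ is the quotient map $\mathrm{Tr}_\Omega\,u=[u]$. For $v\in\mathscr{X}(\Omega,w)$, $S(v)\in\mathscr{L}_{0,L}^{1,2}(\mathcal{C},w)$ denotes the unique minimizer of $\frac12\|u\|^2_{\mathscr{L}_{0,L}^{1,2}(\mathcal{C},w)}$ over all $u\in\mathscr{L}_{0,L}^{1,2}(\mathcal{C},w)$ with $\mathrm{Tr}_\Omega\,u=v$. *)

theory Defs
  imports "HOL-Analysis.Analysis"
begin

section \<open>Smooth functions and weak gradients\<close>

text \<open>For open \<open>U\<close>, all partial derivatives of order at most \<open>k\<close> exist and are continuous on \<open>U\<close>.\<close>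

primrec C_on :: "nat \<Rightarrow> 'e::euclidean_space set \<Rightarrow> ('e \<Rightarrow> real) \<Rightarrow> bool" where
  "C_on 0 U f \<longleftrightarrow> continuous_on U f"
| "C_on (Suc k) U f \<longleftrightarrow> f differentiable_on U \<and>
     (\<forall>b\<in>Basis. C_on k U (\<lambda>x. frechet_derivative f (at x) b))"

definition extends_to_closure :: "'e::euclidean_space set \<Rightarrow> ('e \<Rightarrow> real) \<Rightarrow> bool" where
  "extends_to_closure U f \<longleftrightarrow> (\<exists>g. continuous_on (closure U) g \<and> (\<forall>x\<in>U. g x = f x))"

text \<open>As for \<open>C_on\<close>, but the derivatives also extend continuously to the closure of \<open>U\<close>.\<close>

primrec C_upto_bdry :: "nat \<Rightarrow> 'e::euclidean_space set \<Rightarrow> ('e \<Rightarrow> real) \<Rightarrow> bool" where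
  "C_upto_bdry 0 U f \<longleftrightarrow> extends_to_closure U f"
| "C_upto_bdry (Suc k) U f \<longleftrightarrow> extends_to_closure U f \<and> f differentiable_on U \<and>
     (\<forall>b\<in>Basis. C_upto_bdry k U (\<lambda>x. frechet_derivative f (at x) b))"

definition smooth_on :: "'e::euclidean_space set \<Rightarrow> ('e \<Rightarrow> real) set" where
  "smooth_on U = {u. \<forall>k. C_on k U u}"

definition smooth_on_closure :: "'e::euclidean_space set \<Rightarrow> ('e \<Rightarrow> real) set" where
  "smooth_on_closure U = {u. continuous_on (closure U) u \<and> (\<forall>k. C_upto_bdry k U u)}"

text \<open>
  A function with support in a set is represented by its extension by zero to the whole space:
  the inclusion \<open>supp u \<subseteq> A\<close> below forces \<open>u\<close> to vanish outside \<open>A\<close>.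
\<close>

definition supp :: "('e::euclidean_space \<Rightarrow> real) \<Rightarrow> 'e set" where
  "supp u = closure {x. u x \<noteq> 0}"

definition test_functions :: "'e::euclidean_space set \<Rightarrow> ('e \<Rightarrow> real) set" where
  "test_functions U = {u \<in> smooth_on U. compact (supp u) \<and> supp u \<subseteq> U}"

definition locally_integrable ::
    "'e::euclidean_space set \<Rightarrow> ('e \<Rightarrow> 'b::euclidean_space) \<Rightarrow> bool" where
  "locally_integrable U f \<longleftrightarrow> (\<forall>K. compact K \<and> K \<subseteq> U \<longrightarrow> set_integrable lebesgue K f)"

definition has_weak_gradient ::
    "'e::euclidean_space set \<Rightarrow> ('e \<Rightarrow> real) \<Rightarrow> ('e \<Rightarrow> 'e) \<Rightarrow> bool" where
  "has_weak_gradient U u g \<longleftrightarrow> locally_integrable U u \<and> locally_integrable U g \<and>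
     (\<forall>\<phi>\<in>test_functions U. \<forall>b\<in>Basis.
        integral\<^sup>L (lebesgue_on U) (\<lambda>X. u X * frechet_derivative \<phi> (at X) b)
          = - integral\<^sup>L (lebesgue_on U) (\<lambda>X. (g X \<bullet> b) * \<phi> X))"

text \<open>A representative of the weak gradient, which is determined only almost everywhere.\<close>

definition weak_gradient ::
    "'e::euclidean_space set \<Rightarrow> ('e \<Rightarrow> real) \<Rightarrow> 'e \<Rightarrow> 'e" where
  "weak_gradient U u = (SOME g. has_weak_gradient U u g)"


section \<open>Weighted spaces\<close>

text \<open>Finiteness of a weight is automatic, as it is real-valued.\<close>

definition is_weight :: "'e::euclidean_space set \<Rightarrow> ('e \<Rightarrow> real) \<Rightarrow> bool" where
  "is_weight U w \<longleftrightarrow> w \<in> borel_measurable (lebesgue_on U) \<and> (AE x in lebesgue_on U. 0 < w x)"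

definition L2_weighted ::
    "'e::euclidean_space set \<Rightarrow> ('e \<Rightarrow> real) \<Rightarrow> ('e \<Rightarrow> 'b::euclidean_space) set" where
  "L2_weighted U w = {f \<in> borel_measurable (lebesgue_on U).
     integrable (lebesgue_on U) (\<lambda>X. (norm (f X))\<^sup>2 * w X)}"

definition L12_weighted ::
    "'e::euclidean_space set \<Rightarrow> ('e \<Rightarrow> real) \<Rightarrow> ('e \<Rightarrow> real) set" where
  "L12_weighted U w = {u \<in> borel_measurable (lebesgue_on U).
     \<exists>g. has_weak_gradient U u g \<and> g \<in> L2_weighted U w}"

definition grad_inner ::
    "'e::euclidean_space set \<Rightarrow> ('e \<Rightarrow> real) \<Rightarrow> ('e \<Rightarrow> real) \<Rightarrow> ('e \<Rightarrow> real) \<Rightarrow> real" where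
  "grad_inner U w u1 u2 =
     integral\<^sup>L (lebesgue_on U) (\<lambda>X. w X * (weak_gradient U u1 X \<bullet> weak_gradient U u2 X))"


section \<open>Completions, quotients and duals\<close>

text \<open>
  The spaces depend on \<open>\<Omega>\<close> and \<open>w\<close>, hence cannot be types; they are records with explicit carriers.
\<close>

record 'a lin_space =
  elems :: "'a set"
  add :: "'a \<Rightarrow> 'a \<Rightarrow> 'a"
  scale :: "real \<Rightarrow> 'a \<Rightarrow> 'a"

record 'a inner_space = "'a lin_space" +
  ip :: "'a \<Rightarrow> 'a \<Rightarrow> real"

record 'a normed_space = "'a lin_space" +
  nrm :: "'a \<Rightarrow> real"

definition diff :: "('a, 'z) lin_space_scheme \<Rightarrow> 'a \<Rightarrow> 'a \<Rightarrow> 'a" where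
  "diff H u v = add H u (scale H (- 1) v)"

definition ip_norm :: "('a, 'z) inner_space_scheme \<Rightarrow> 'a \<Rightarrow> real" where
  "ip_norm H u = sqrt (ip H u u)"

definition cauchy_seqs :: "'a inner_space \<Rightarrow> (nat \<Rightarrow> 'a) set" where
  "cauchy_seqs H = {f. (\<forall>n. f n \<in> elems H) \<and>
     (\<forall>e>0. \<exists>M. \<forall>m\<ge>M. \<forall>n\<ge>M. ip_norm H (diff H (f m) (f n)) < e)}"

definition cauchy_rel :: "'a inner_space \<Rightarrow> ((nat \<Rightarrow> 'a) \<times> (nat \<Rightarrow> 'a)) set" where
  "cauchy_rel H = {(f, g). f \<in> cauchy_seqs H \<and> g \<in> cauchy_seqs H \<and>
     (\<lambda>n. ip_norm H (diff H (f n) (g n))) \<longlonglongrightarrow> 0}"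

definition hilbert_completion :: "'a inner_space \<Rightarrow> (nat \<Rightarrow> 'a) set inner_space" where
  "hilbert_completion H =
     \<lparr> elems = cauchy_seqs H // cauchy_rel H,
       add = (\<lambda>P Q. \<Union>f\<in>P. \<Union>g\<in>Q. cauchy_rel H `` {\<lambda>n. add H (f n) (g n)}),
       scale = (\<lambda>c P. \<Union>f\<in>P. cauchy_rel H `` {\<lambda>n. scale H c (f n)}),
       ip = (\<lambda>P Q. THE l. \<exists>f\<in>P. \<exists>g\<in>Q. (\<lambda>n. ip H (f n) (g n)) \<longlonglongrightarrow> l) \<rparr>"

text \<open>
  If \<open>H0\<close> is a subspace of \<open>H\<close>, this is the image of the completion of \<open>H0\<close> under its canonical
  isometric embedding into the completion of \<open>H\<close>: a class of Cauchy sequences in \<open>H0\<close> is sent to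
  the class, in \<open>H\<close>, of the same sequences.
\<close>

definition sub_completion :: "'a inner_space \<Rightarrow> 'a inner_space \<Rightarrow> (nat \<Rightarrow> 'a) set set" where
  "sub_completion H H0 = (\<lambda>P. cauchy_rel H `` P) ` elems (hilbert_completion H0)"

definition coset :: "('a, 'z) lin_space_scheme \<Rightarrow> 'a set \<Rightarrow> 'a \<Rightarrow> 'a set" where
  "coset H M u = {u' \<in> elems H. diff H u' u \<in> M}"

definition quotient_space :: "'a inner_space \<Rightarrow> 'a set \<Rightarrow> 'a set normed_space" where
  "quotient_space H M =
     \<lparr> elems = coset H M ` elems H,
       add = (\<lambda>P Q. \<Union>u\<in>P. \<Union>v\<in>Q. coset H M (add H u v)),
       scale = (\<lambda>c P. \<Union>u\<in>P. coset H M (scale H c u)),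
       nrm = (\<lambda>P. INF u\<in>P. ip_norm H u) \<rparr>"

text \<open>
  The duality pairing is application. Functionals are normalised to be \<open>undefined\<close> off the carrier,
  so that equality in the dual is equality on the carrier.
\<close>

definition dual :: "'a normed_space \<Rightarrow> ('a \<Rightarrow> real) set" where
  "dual X = {l \<in> extensional (elems X).
     (\<forall>u\<in>elems X. \<forall>v\<in>elems X. l (add X u v) = l u + l v) \<and>
     (\<forall>c. \<forall>u\<in>elems X. l (scale X c u) = c * l u) \<and>
     (\<exists>K. \<forall>u\<in>elems X. \<bar>l u\<bar> \<le> K * nrm X u)}"


section \<open>The spaces on the cylinder\<close>

definition cyl :: "(real^'n) set \<Rightarrow> ((real^'n) \<times> real) set" where
  "cyl \<Omega> = \<Omega> \<times> {0<..}"

definition cyl_base :: "(real^'n) set \<Rightarrow> ((real^'n) \<times> real) set" where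
  "cyl_base \<Omega> = cyl \<Omega> \<union> \<Omega> \<times> {0}"

definition cyl_weight :: "(real^'n \<Rightarrow> real) \<Rightarrow> (real^'n \<Rightarrow> real) \<Rightarrow> (real^'n) \<times> real \<Rightarrow> real" where
  "cyl_weight s G = (\<lambda>(x, y). G x * y powr (1 - 2 * s x))"

definition test_functions_base :: "(real^'n) set \<Rightarrow> ((real^'n) \<times> real \<Rightarrow> real) set" where
  "test_functions_base \<Omega> =
     {u \<in> smooth_on_closure (cyl \<Omega>). compact (supp u) \<and> supp u \<subseteq> cyl_base \<Omega>}"

definition grad_space ::
    "(real^'n) set \<Rightarrow> ((real^'n) \<times> real \<Rightarrow> real) \<Rightarrow> ((real^'n) \<times> real \<Rightarrow> real) set
      \<Rightarrow> ((real^'n) \<times> real \<Rightarrow> real) inner_space" where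
  "grad_space \<Omega> w V =
     \<lparr> elems = V \<inter> L12_weighted (cyl \<Omega>) w,
       add = (\<lambda>u v X. u X + v X),
       scale = (\<lambda>c u X. c * u X),
       ip = grad_inner (cyl \<Omega>) w \<rparr>"

type_synonym 'n L_elem = "(nat \<Rightarrow> (real^'n) \<times> real \<Rightarrow> real) set"

definition L_0L :: "(real^'n) set \<Rightarrow> ((real^'n) \<times> real \<Rightarrow> real) \<Rightarrow> 'n L_elem inner_space" where
  "L_0L \<Omega> w = hilbert_completion (grad_space \<Omega> w (test_functions_base \<Omega>))"

text \<open>The completion of the test functions on the open cylinder, as a subspace of \<open>L_0L \<Omega> w\<close>.\<close>

definition L_0 :: "(real^'n) set \<Rightarrow> ((real^'n) \<times> real \<Rightarrow> real) \<Rightarrow> 'n L_elem set" where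
  "L_0 \<Omega> w = sub_completion (grad_space \<Omega> w (test_functions_base \<Omega>))
                            (grad_space \<Omega> w (test_functions (cyl \<Omega>)))"

definition X_space ::
    "(real^'n) set \<Rightarrow> ((real^'n) \<times> real \<Rightarrow> real) \<Rightarrow> 'n L_elem set normed_space" where
  "X_space \<Omega> w = quotient_space (L_0L \<Omega> w) (L_0 \<Omega> w)"

definition Tr :: "(real^'n) set \<Rightarrow> ((real^'n) \<times> real \<Rightarrow> real) \<Rightarrow> 'n L_elem \<Rightarrow> 'n L_elem set" where
  "Tr \<Omega> w u = coset (L_0L \<Omega> w) (L_0 \<Omega> w) u"

definition S_min :: "(real^'n) set \<Rightarrow> ((real^'n) \<times> real \<Rightarrow> real) \<Rightarrow> 'n L_elem set \<Rightarrow> 'n L_elem" where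
  "S_min \<Omega> w v = (THE u. is_arg_min (\<lambda>u. 1 / 2 * (ip_norm (L_0L \<Omega> w) u)\<^sup>2)
                                    (\<lambda>u. u \<in> elems (L_0L \<Omega> w) \<and> Tr \<Omega> w u = v) u)"

end

theory Submission
  imports Defs
begin

text \<open>
  The theorem is the Hilbert space fact that the element \<open>S\<close> of least norm in a coset \<open>u + M\<close> is
  orthogonal to \<open>M\<close>. Hence \<open>\<psi> \<mapsto> (S, \<psi>)\<close> depends only on the coset of \<open>\<psi>\<close> and so defines a linear
  functional on the quotient, bounded by the norm of \<open>S\<close> (by Cauchy-Schwarz for every representative
  of the coset); there is only one such functional, because every element of the quotient is the trace
  of some \<open>\<psi>\<close> (\<open>unique_functional_of_minimiser\<close>).

  The minimiser exists and is unique as soon as \<open>M\<close> admits orthogonal projections. For the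
  completion \<open>M\<close> of a subspace \<open>V0\<close> of test functions these are constructed on representatives: given a
  Cauchy sequence \<open>f\<close>, choose \<open>g n\<close> in \<open>V0\<close> that minimises the distance to \<open>f n\<close> up to an error tending to
  \<open>0\<close>. Then \<open>f n - g n\<close> is almost orthogonal to \<open>V0\<close>, which forces \<open>g\<close> to be a Cauchy sequence, and its
  class is the projection of the class of \<open>f\<close> (\<open>projection_completion\<close>).

  This theory applies once the gradient form is a semi-inner product on the test functions. Its
  bilinearity is not immediate, because the weak gradient is an arbitrarily chosen representative. It
  follows from uniqueness almost everywhere of weak gradients, that is, from the fundamental lemma of
  the calculus of variations (\<open>AE_zero_if_orthogonal_to_test_functions\<close>). The test functions for that
  lemma are products of factors \<open>exp (- c / t)\<close>, one for each distance \<open>t\<close> of a coordinate to an end of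
  a box; they are smooth with support in the box and converge to the indicator function of the open
  box as \<open>c\<close> tends to \<open>0\<close>. Integrability of the
  products of gradients, and positivity of the form, use that \<open>G x * y powr (1 - 2 * s x)\<close> is
  measurable and positive almost everywhere on the cylinder (\<open>is_weight_cyl_weight\<close>).
\<close>

section \<open>Semi-inner products\<close>

lemma discriminant_bound:
  fixes a b c :: real
  assumes nonneg: "\<And>t. 0 \<le> a - 2 * t * b + t\<^sup>2 * c" and "0 \<le> c"
  shows "b\<^sup>2 \<le> a * c"
proof (cases "c = 0")
  case True
  have "b = 0"
  proof (rule ccontr)
    assume "b \<noteq> 0"
    then show False
      using nonneg[of "(a + 1) / (2 * b)"] True by (simp add: field_simps)
  qed
  with True show ?thesis by simp
next
  case False
  with \<open>0 \<le> c\<close> have "c > 0" by simp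
  then show ?thesis
    using nonneg[of "b / c"] by (simp add: field_simps power2_eq_square)
qed

text \<open>
  The test functions with the gradient form are the intended instance. Only bilinearity, symmetry and
  positivity of the form on the carrier are required; vectors are compared through the form alone.
\<close>

locale semi_ip_space =
  fixes H :: "'a inner_space"
  assumes add_closed: "u \<in> elems H \<Longrightarrow> v \<in> elems H \<Longrightarrow> add H u v \<in> elems H"
    and scale_closed: "u \<in> elems H \<Longrightarrow> scale H c u \<in> elems H"
    and ip_commute: "u \<in> elems H \<Longrightarrow> v \<in> elems H \<Longrightarrow> ip H u v = ip H v u"
    and ip_add_left: "u \<in> elems H \<Longrightarrow> v \<in> elems H \<Longrightarrow> x \<in> elems H \<Longrightarrow>
          ip H (add H u v) x = ip H u x + ip H v x"
    and ip_scale_left: "u \<in> elems H \<Longrightarrow> x \<in> elems H \<Longrightarrow> ip H (scale H c u) x = c * ip H u x"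
    and ip_nonneg: "u \<in> elems H \<Longrightarrow> 0 \<le> ip H u u"
begin

abbreviation N where "N \<equiv> ip_norm H"

lemma diff_closed: "u \<in> elems H \<Longrightarrow> v \<in> elems H \<Longrightarrow> diff H u v \<in> elems H"
  by (simp add: diff_def add_closed scale_closed)

lemmas closed = add_closed scale_closed diff_closed

lemma ip_diff_left:
  "u \<in> elems H \<Longrightarrow> v \<in> elems H \<Longrightarrow> x \<in> elems H \<Longrightarrow> ip H (diff H u v) x = ip H u x - ip H v x"
  by (simp add: diff_def closed ip_add_left ip_scale_left)

lemma ip_add_right:
  "u \<in> elems H \<Longrightarrow> v \<in> elems H \<Longrightarrow> x \<in> elems H \<Longrightarrow> ip H x (add H u v) = ip H x u + ip H x v"
  using ip_add_left ip_commute closed by metis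

lemma ip_scale_right:
  "u \<in> elems H \<Longrightarrow> x \<in> elems H \<Longrightarrow> ip H x (scale H c u) = c * ip H x u"
  using ip_scale_left ip_commute closed by metis

lemma ip_diff_right:
  "u \<in> elems H \<Longrightarrow> v \<in> elems H \<Longrightarrow> x \<in> elems H \<Longrightarrow> ip H x (diff H u v) = ip H x u - ip H x v"
  by (simp add: diff_def closed ip_add_right ip_scale_right)

lemmas ip_expand = ip_add_left ip_scale_left ip_diff_left ip_add_right ip_scale_right ip_diff_right
  closed

lemma norm_nonneg: "u \<in> elems H \<Longrightarrow> 0 \<le> N u"
  by (simp add: ip_norm_def ip_nonneg)

lemma norm_sq: "u \<in> elems H \<Longrightarrow> (N u)\<^sup>2 = ip H u u"
  by (simp add: ip_norm_def ip_nonneg)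

lemma Cauchy_Schwarz:
  assumes "u \<in> elems H" "v \<in> elems H"
  shows "\<bar>ip H u v\<bar> \<le> N u * N v"
proof -
  have "(ip H u v)\<^sup>2 \<le> ip H u u * ip H v v"
  proof (rule discriminant_bound)
    fix t
    have "0 \<le> ip H (diff H u (scale H t v)) (diff H u (scale H t v))"
      using assms by (simp add: ip_nonneg closed)
    also have "\<dots> = ip H u u - 2 * t * ip H u v + t\<^sup>2 * ip H v v"
      using assms ip_commute[of u v] by (simp add: ip_expand algebra_simps power2_eq_square)
    finally show "0 \<le> \<dots>" .
  qed (use assms in \<open>simp add: ip_nonneg\<close>)
  also have "\<dots> = (N u * N v)\<^sup>2"
    using assms by (simp add: power_mult_distrib norm_sq)
  finally show ?thesis
    using assms by (metis abs_le_square_iff abs_of_nonneg mult_nonneg_nonneg norm_nonneg)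
qed

lemma norm_add_le:
  assumes "u \<in> elems H" "v \<in> elems H"
  shows "N (add H u v) \<le> N u + N v"
proof (rule power2_le_imp_le)
  have "(N (add H u v))\<^sup>2 = ip H u u + 2 * ip H u v + ip H v v"
    using assms ip_commute[of u v] by (simp add: norm_sq ip_expand)
  also have "\<dots> \<le> (N u)\<^sup>2 + 2 * (N u * N v) + (N v)\<^sup>2"
    using assms Cauchy_Schwarz[of u v] by (simp add: norm_sq)
  also have "\<dots> = (N u + N v)\<^sup>2"
    by (simp add: power2_eq_square algebra_simps)
  finally show "(N (add H u v))\<^sup>2 \<le> (N u + N v)\<^sup>2" .
qed (use assms in \<open>simp add: norm_nonneg\<close>)

text \<open>
  Identities between norms of combinations follow by expanding inner products, because such a norm is
  determined by the mutual inner products of the vectors; this replaces the vector space laws.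
\<close>

lemma norm_eqI: "ip H u u = ip H v v \<Longrightarrow> N u = N v"
  by (simp add: ip_norm_def)

lemma norm_diff_commute:
  "u \<in> elems H \<Longrightarrow> v \<in> elems H \<Longrightarrow> N (diff H u v) = N (diff H v u)"
  by (rule norm_eqI) (simp add: ip_expand)

lemma norm_diff_self: "u \<in> elems H \<Longrightarrow> N (diff H u u) = 0"
  by (simp add: ip_norm_def ip_expand)

lemma norm_diff_triangle:
  assumes "u \<in> elems H" "v \<in> elems H" "x \<in> elems H"
  shows "N (diff H u x) \<le> N (diff H u v) + N (diff H v x)"
proof -
  have "N (diff H u x) = N (add H (diff H u v) (diff H v x))"
    by (rule norm_eqI) (use assms in \<open>simp add: ip_expand\<close>)
  also have "\<dots> \<le> N (diff H u v) + N (diff H v x)"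
    using assms by (intro norm_add_le closed)
  finally show ?thesis .
qed

lemma norm_scale: "u \<in> elems H \<Longrightarrow> N (scale H c u) = \<bar>c\<bar> * N u"
  by (simp add: ip_norm_def ip_expand real_sqrt_mult flip: mult.assoc power2_eq_square)

lemma norm_diff_le:
  assumes "u \<in> elems H" "v \<in> elems H"
  shows "\<bar>N u - N v\<bar> \<le> N (diff H u v)"
proof -
  have *: "N u - N v \<le> N (diff H u v)" if "u \<in> elems H" "v \<in> elems H" for u v
  proof -
    have "N u = N (add H (diff H u v) v)"
      by (rule norm_eqI) (use that in \<open>simp add: ip_expand\<close>)
    also have "\<dots> \<le> N (diff H u v) + N v"
      using that by (intro norm_add_le closed)
    finally show ?thesis by simp
  qed
  show ?thesis
    using *[of u v] *[of v u] assms norm_diff_commute[of u v] by simp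
qed

lemma norm_diff_add_add:
  assumes "u \<in> elems H" "v \<in> elems H" "u' \<in> elems H" "v' \<in> elems H"
  shows "N (diff H (add H u v) (add H u' v')) \<le> N (diff H u u') + N (diff H v v')"
proof -
  have "N (diff H (add H u v) (add H u' v')) = N (add H (diff H u u') (diff H v v'))"
    by (rule norm_eqI) (use assms in \<open>simp add: ip_expand\<close>)
  also have "\<dots> \<le> N (diff H u u') + N (diff H v v')"
    using assms by (intro norm_add_le closed)
  finally show ?thesis .
qed

lemma norm_diff_scale_scale:
  assumes "u \<in> elems H" "v \<in> elems H"
  shows "N (diff H (scale H c u) (scale H c v)) = \<bar>c\<bar> * N (diff H u v)"
proof -
  have "N (diff H (scale H c u) (scale H c v)) = N (scale H c (diff H u v))"
    by (rule norm_eqI) (use assms in \<open>simp add: ip_expand algebra_simps\<close>)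
  with assms show ?thesis by (simp add: norm_scale closed)
qed

lemma polarisation:
  "u \<in> elems H \<Longrightarrow> v \<in> elems H \<Longrightarrow> ip H u v = ((N (add H u v))\<^sup>2 - (N (diff H u v))\<^sup>2) / 4"
  using ip_commute[of u v] by (simp add: norm_sq ip_expand)

end

section \<open>The completion of a semi-inner product space\<close>

context semi_ip_space
begin

abbreviation cl where "cl f \<equiv> cauchy_rel H `` {f}"

lemma cauchyD: "f \<in> cauchy_seqs H \<Longrightarrow> f n \<in> elems H"
  by (simp add: cauchy_seqs_def)

lemma cauchyE:
  assumes "f \<in> cauchy_seqs H" "e > 0"
  obtains M where "\<And>m n. m \<ge> M \<Longrightarrow> n \<ge> M \<Longrightarrow> N (diff H (f m) (f n)) < e"
  using assms unfolding cauchy_seqs_def by blast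

lemma cauchyI:
  assumes "\<And>n. f n \<in> elems H"
    and "\<And>e. e > 0 \<Longrightarrow> \<exists>M. \<forall>m\<ge>M. \<forall>n\<ge>M. N (diff H (f m) (f n)) < e"
  shows "f \<in> cauchy_seqs H"
  using assms unfolding cauchy_seqs_def by blast

lemma cauchy_const: "u \<in> elems H \<Longrightarrow> (\<lambda>n. u) \<in> cauchy_seqs H"
  by (rule cauchyI) (auto simp: norm_diff_self)

lemma cauchy_add:
  assumes f: "f \<in> cauchy_seqs H" and g: "g \<in> cauchy_seqs H"
  shows "(\<lambda>n. add H (f n) (g n)) \<in> cauchy_seqs H"
proof (rule cauchyI)
  fix e :: real assume "e > 0"
  then have "e / 2 > 0" by simp
  obtain M1 where M1: "\<And>m n. m \<ge> M1 \<Longrightarrow> n \<ge> M1 \<Longrightarrow> N (diff H (f m) (f n)) < e / 2"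
    using cauchyE[OF f \<open>e / 2 > 0\<close>] by blast
  obtain M2 where M2: "\<And>m n. m \<ge> M2 \<Longrightarrow> n \<ge> M2 \<Longrightarrow> N (diff H (g m) (g n)) < e / 2"
    using cauchyE[OF g \<open>e / 2 > 0\<close>] by blast
  have "N (diff H (add H (f m) (g m)) (add H (f n) (g n))) < e"
    if "m \<ge> max M1 M2" "n \<ge> max M1 M2" for m n
    using norm_diff_add_add[of "f m" "g m" "f n" "g n"] M1[of m n] M2[of m n] that
      cauchyD[OF f] cauchyD[OF g] by force
  then show "\<exists>M. \<forall>m\<ge>M. \<forall>n\<ge>M. N (diff H (add H (f m) (g m)) (add H (f n) (g n))) < e"
    by blast
qed (simp add: f g cauchyD closed)

lemma cauchy_scale:
  assumes f: "f \<in> cauchy_seqs H"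
  shows "(\<lambda>n. scale H c (f n)) \<in> cauchy_seqs H"
proof (rule cauchyI)
  fix e :: real assume "e > 0"
  then have "e / (\<bar>c\<bar> + 1) > 0" by simp
  then obtain M where M: "\<And>m n. m \<ge> M \<Longrightarrow> n \<ge> M \<Longrightarrow> N (diff H (f m) (f n)) < e / (\<bar>c\<bar> + 1)"
    using cauchyE[OF f] by blast
  have "N (diff H (scale H c (f m)) (scale H c (f n))) < e" if "m \<ge> M" "n \<ge> M" for m n
  proof -
    have "\<bar>c\<bar> * N (diff H (f m) (f n)) \<le> (\<bar>c\<bar> + 1) * N (diff H (f m) (f n))"
      by (intro mult_right_mono norm_nonneg closed cauchyD[OF f]) simp
    also have "\<dots> < e" using M[OF that] by (simp add: field_simps)
    finally show ?thesis by (simp add: norm_diff_scale_scale cauchyD[OF f])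
  qed
  then show "\<exists>M. \<forall>m\<ge>M. \<forall>n\<ge>M. N (diff H (scale H c (f m)) (scale H c (f n))) < e"
    by blast
qed (simp add: f cauchyD closed)

lemma cauchy_diff:
  "f \<in> cauchy_seqs H \<Longrightarrow> g \<in> cauchy_seqs H \<Longrightarrow> (\<lambda>n. diff H (f n) (g n)) \<in> cauchy_seqs H"
  unfolding diff_def by (intro cauchy_add cauchy_scale)

lemma cauchy_relI:
  assumes "f \<in> cauchy_seqs H" "g \<in> cauchy_seqs H"
    and "e \<longlonglongrightarrow> 0" "\<And>n. N (diff H (f n) (g n)) \<le> e n"
  shows "(f, g) \<in> cauchy_rel H"
proof -
  have "(\<lambda>n. N (diff H (f n) (g n))) \<longlonglongrightarrow> 0"
    by (rule tendsto_sandwich[OF _ _ tendsto_const \<open>e \<longlonglongrightarrow> 0\<close>])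
      (use assms in \<open>simp_all add: norm_nonneg closed cauchyD\<close>)
  with assms show ?thesis by (simp add: cauchy_rel_def)
qed

lemma cauchy_relD:
  assumes "(f, g) \<in> cauchy_rel H"
  shows "f \<in> cauchy_seqs H" "g \<in> cauchy_seqs H" "(\<lambda>n. N (diff H (f n) (g n))) \<longlonglongrightarrow> 0"
  using assms by (simp_all add: cauchy_rel_def)

lemma equiv_cauchy_rel: "equiv (cauchy_seqs H) (cauchy_rel H)"
proof (rule equivI)
  show "cauchy_rel H \<subseteq> cauchy_seqs H \<times> cauchy_seqs H"
    by (auto simp: cauchy_rel_def)
  show "refl_on (cauchy_seqs H) (cauchy_rel H)"
    by (auto simp: refl_on_def cauchy_rel_def norm_diff_self cauchyD)
  show "sym (cauchy_rel H)"
    by (auto simp: sym_def cauchy_rel_def norm_diff_commute cauchyD)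
  show "trans (cauchy_rel H)"
  proof (rule transI)
    fix f g h assume fg: "(f, g) \<in> cauchy_rel H" and gh: "(g, h) \<in> cauchy_rel H"
    show "(f, h) \<in> cauchy_rel H"
    proof (rule cauchy_relI)
      show "(\<lambda>n. N (diff H (f n) (g n)) + N (diff H (g n) (h n))) \<longlonglongrightarrow> 0"
        using tendsto_add[OF cauchy_relD(3)[OF fg] cauchy_relD(3)[OF gh]] by simp
    qed (simp_all add: cauchy_relD(1,2)[OF fg] cauchy_relD(1,2)[OF gh] norm_diff_triangle cauchyD)
  qed
qed

lemma cl_eq_iff:
  "f \<in> cauchy_seqs H \<Longrightarrow> g \<in> cauchy_seqs H \<Longrightarrow>
    cl f = cl g \<longleftrightarrow> (\<lambda>n. N (diff H (f n) (g n))) \<longlonglongrightarrow> 0"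
  by (subst eq_equiv_class_iff[OF equiv_cauchy_rel]) (auto simp: cauchy_rel_def)

lemma cl_eqI: "(f, g) \<in> cauchy_rel H \<Longrightarrow> cl f = cl g"
  using equiv_cauchy_rel by (rule equiv_class_eq)

lemma mem_cl: "f \<in> cauchy_seqs H \<Longrightarrow> f \<in> cl f"
  by (rule equiv_class_self[OF equiv_cauchy_rel])

lemma elems_completion: "elems (hilbert_completion H) = cl ` cauchy_seqs H"
  by (auto simp: hilbert_completion_def quotient_def)

lemma add_cl:
  assumes f: "f \<in> cauchy_seqs H" and g: "g \<in> cauchy_seqs H"
  shows "add (hilbert_completion H) (cl f) (cl g) = cl (\<lambda>n. add H (f n) (g n))"
proof -
  have eq: "cl (\<lambda>n. add H (f' n) (g' n)) = cl (\<lambda>n. add H (f n) (g n))"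
    if ff': "(f, f') \<in> cauchy_rel H" and gg': "(g, g') \<in> cauchy_rel H" for f' g'
  proof (rule cl_eqI[symmetric], rule cauchy_relI)
    show "(\<lambda>n. N (diff H (f n) (f' n)) + N (diff H (g n) (g' n))) \<longlonglongrightarrow> 0"
      using tendsto_add[OF cauchy_relD(3)[OF ff'] cauchy_relD(3)[OF gg']] by simp
  qed (simp_all add: cauchy_relD(1,2)[OF ff'] cauchy_relD(1,2)[OF gg'] cauchy_add
      norm_diff_add_add cauchyD)
  have "(\<Union>f'\<in>cl f. \<Union>g'\<in>cl g. cl (\<lambda>n. add H (f' n) (g' n))) = cl (\<lambda>n. add H (f n) (g n))"
  proof (intro SUP_eq_const)
    show "cl f \<noteq> {}" "cl g \<noteq> {}" using mem_cl f g by blast+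
  qed (rule eq, simp_all)
  then show ?thesis by (simp add: hilbert_completion_def)
qed

lemma scale_cl:
  assumes f: "f \<in> cauchy_seqs H"
  shows "scale (hilbert_completion H) c (cl f) = cl (\<lambda>n. scale H c (f n))"
proof -
  have eq: "cl (\<lambda>n. scale H c (f' n)) = cl (\<lambda>n. scale H c (f n))"
    if ff': "(f, f') \<in> cauchy_rel H" for f'
  proof (rule cl_eqI[symmetric], rule cauchy_relI)
    show "(\<lambda>n. \<bar>c\<bar> * N (diff H (f n) (f' n))) \<longlonglongrightarrow> 0"
      using tendsto_mult_right_zero[OF cauchy_relD(3)[OF ff']] by simp
  qed (simp_all add: cauchy_relD(1,2)[OF ff'] cauchy_scale norm_diff_scale_scale cauchyD)
  have "(\<Union>f'\<in>cl f. cl (\<lambda>n. scale H c (f' n))) = cl (\<lambda>n. scale H c (f n))"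
  proof (intro SUP_eq_const)
    show "cl f \<noteq> {}" using mem_cl f by blast
  qed (rule eq, simp_all)
  then show ?thesis by (simp add: hilbert_completion_def)
qed

lemma diff_cl:
  assumes f: "f \<in> cauchy_seqs H" and g: "g \<in> cauchy_seqs H"
  shows "diff (hilbert_completion H) (cl f) (cl g) = cl (\<lambda>n. diff H (f n) (g n))"
  by (simp add: diff_def add_cl scale_cl cauchy_scale f g)

lemma norm_convergent:
  assumes f: "f \<in> cauchy_seqs H"
  shows "convergent (\<lambda>n. N (f n))"
proof -
  have "Cauchy (\<lambda>n. N (f n))"
  proof (rule CauchyI)
    fix e :: real assume "e > 0"
    then obtain M where M: "\<And>m n. m \<ge> M \<Longrightarrow> n \<ge> M \<Longrightarrow> N (diff H (f m) (f n)) < e"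
      using cauchyE[OF f] by blast
    then have "norm (N (f m) - N (f n)) < e" if "m \<ge> M" "n \<ge> M" for m n
      using norm_diff_le[of "f m" "f n"] that by (fastforce simp: cauchyD[OF f])
    then show "\<exists>M. \<forall>m\<ge>M. \<forall>n\<ge>M. norm (N (f m) - N (f n)) < e" by blast
  qed
  then show ?thesis by (simp add: Cauchy_convergent_iff)
qed

lemma norm_limit_unique:
  assumes ff': "(f, f') \<in> cauchy_rel H" and l: "(\<lambda>n. N (f n)) \<longlonglongrightarrow> l"
  shows "(\<lambda>n. N (f' n)) \<longlonglongrightarrow> l"
proof -
  note D = cauchy_relD[OF ff']
  have "(\<lambda>n. N (f n) - N (f' n)) \<longlonglongrightarrow> 0"
    by (rule Lim_null_comparison[OF _ D(3)])
      (use norm_diff_le D cauchyD in \<open>auto intro!: always_eventually\<close>)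
  from tendsto_diff[OF l this] show ?thesis by simp
qed

text \<open>By polarisation, limits of inner products reduce to limits of norms.\<close>

lemma ip_convergent:
  assumes f: "f \<in> cauchy_seqs H" and g: "g \<in> cauchy_seqs H"
  obtains l where "\<And>f' g'. (f, f') \<in> cauchy_rel H \<Longrightarrow> (g, g') \<in> cauchy_rel H \<Longrightarrow>
    (\<lambda>n. ip H (f' n) (g' n)) \<longlonglongrightarrow> l"
proof -
  obtain p where p: "(\<lambda>n. N (add H (f n) (g n))) \<longlonglongrightarrow> p"
    using norm_convergent[OF cauchy_add[OF f g]] by (auto simp: convergent_def)
  obtain q where q: "(\<lambda>n. N (diff H (f n) (g n))) \<longlonglongrightarrow> q"
    using norm_convergent[OF cauchy_diff[OF f g]] by (auto simp: convergent_def)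
  show thesis
  proof (rule that[of "(p\<^sup>2 - q\<^sup>2) / 4"])
    fix f' g' assume ff': "(f, f') \<in> cauchy_rel H" and gg': "(g, g') \<in> cauchy_rel H"
    note D = cauchy_relD(2)[OF ff'] cauchy_relD(2)[OF gg']
    have eq: "cl f = cl f'" "cl g = cl g'"
      by (rule cl_eqI[OF ff'], rule cl_eqI[OF gg'])
    have "cl (\<lambda>n. add H (f n) (g n)) = cl (\<lambda>n. add H (f' n) (g' n))"
      using add_cl[OF f g] add_cl[OF D] eq by simp
    then have "(\<lambda>n. add H (f n) (g n), \<lambda>n. add H (f' n) (g' n)) \<in> cauchy_rel H"
      using eq_equiv_class_iff[OF equiv_cauchy_rel cauchy_add[OF f g] cauchy_add[OF D]] by simp
    then have p': "(\<lambda>n. N (add H (f' n) (g' n))) \<longlonglongrightarrow> p"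
      using p by (rule norm_limit_unique)
    have "cl (\<lambda>n. diff H (f n) (g n)) = cl (\<lambda>n. diff H (f' n) (g' n))"
      using diff_cl[OF f g] diff_cl[OF D] eq by simp
    then have "(\<lambda>n. diff H (f n) (g n), \<lambda>n. diff H (f' n) (g' n)) \<in> cauchy_rel H"
      using eq_equiv_class_iff[OF equiv_cauchy_rel cauchy_diff[OF f g] cauchy_diff[OF D]] by simp
    then have q': "(\<lambda>n. N (diff H (f' n) (g' n))) \<longlonglongrightarrow> q"
      using q by (rule norm_limit_unique)
    have "(\<lambda>n. ((N (add H (f' n) (g' n)))\<^sup>2 - (N (diff H (f' n) (g' n)))\<^sup>2) / 4)
        \<longlonglongrightarrow> (p\<^sup>2 - q\<^sup>2) / 4"
      by (intro tendsto_intros p' q') auto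
    then show "(\<lambda>n. ip H (f' n) (g' n)) \<longlonglongrightarrow> (p\<^sup>2 - q\<^sup>2) / 4"
      by (simp add: polarisation cauchyD D)
  qed
qed

lemma ip_cl_tendsto:
  assumes f: "f \<in> cauchy_seqs H" and g: "g \<in> cauchy_seqs H"
  shows "(\<lambda>n. ip H (f n) (g n)) \<longlonglongrightarrow> ip (hilbert_completion H) (cl f) (cl g)"
proof -
  obtain l where l: "\<And>f' g'. (f, f') \<in> cauchy_rel H \<Longrightarrow> (g, g') \<in> cauchy_rel H \<Longrightarrow>
      (\<lambda>n. ip H (f' n) (g' n)) \<longlonglongrightarrow> l"
    using ip_convergent[OF f g] by blast
  have self: "(f, f) \<in> cauchy_rel H" "(g, g) \<in> cauchy_rel H"
    using mem_cl[OF f] mem_cl[OF g] by auto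
  have "(THE l. \<exists>f'\<in>cl f. \<exists>g'\<in>cl g. (\<lambda>n. ip H (f' n) (g' n)) \<longlonglongrightarrow> l) = l"
  proof (rule the_equality)
    show "\<exists>f'\<in>cl f. \<exists>g'\<in>cl g. (\<lambda>n. ip H (f' n) (g' n)) \<longlonglongrightarrow> l"
      using l[OF self] self by auto
  next
    fix l' assume "\<exists>f'\<in>cl f. \<exists>g'\<in>cl g. (\<lambda>n. ip H (f' n) (g' n)) \<longlonglongrightarrow> l'"
    then show "l' = l" using l LIMSEQ_unique by blast
  qed
  then show ?thesis using l[OF self] by (simp add: hilbert_completion_def)
qed

lemma ip_cl_eqI:
  "f \<in> cauchy_seqs H \<Longrightarrow> g \<in> cauchy_seqs H \<Longrightarrow> (\<lambda>n. ip H (f n) (g n)) \<longlonglongrightarrow> l \<Longrightarrow>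
    ip (hilbert_completion H) (cl f) (cl g) = l"
  using ip_cl_tendsto LIMSEQ_unique by blast

end

text \<open>
  In a definite space \<open>u = v\<close> amounts to \<open>ip (u - v) (u - v) = 0\<close>; hence an identity of linear
  algebra holds on the carrier as soon as expanding this inner product yields \<open>0\<close>. The vector space
  laws are recovered in this way.
\<close>

locale ip_space = semi_ip_space +
  assumes definite: "u \<in> elems H \<Longrightarrow> v \<in> elems H \<Longrightarrow> ip H (diff H u v) (diff H u v) = 0 \<Longrightarrow> u = v"

lemma (in semi_ip_space) ip_space_completion: "ip_space (hilbert_completion H)"
proof
  let ?K = "hilbert_completion H"
  fix P Q R :: "(nat \<Rightarrow> 'a) set" and c :: real
  show "add ?K P Q \<in> elems ?K" if "P \<in> elems ?K" "Q \<in> elems ?K"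
    using that by (auto simp: elems_completion add_cl intro!: imageI cauchy_add)
  show "scale ?K c P \<in> elems ?K" if "P \<in> elems ?K"
    using that by (auto simp: elems_completion scale_cl intro!: imageI cauchy_scale)
  show "ip ?K P Q = ip ?K Q P" if PQ: "P \<in> elems ?K" "Q \<in> elems ?K"
  proof -
    obtain f g where f: "f \<in> cauchy_seqs H" "P = cl f" and g: "g \<in> cauchy_seqs H" "Q = cl g"
      using PQ by (auto simp: elems_completion)
    show ?thesis
      unfolding f g by (rule ip_cl_eqI[OF f(1) g(1)])
        (use ip_cl_tendsto[OF g(1) f(1)] f g in \<open>simp add: ip_commute cauchyD\<close>)
  qed
  show "ip ?K (add ?K P Q) R = ip ?K P R + ip ?K Q R"
    if PQR: "P \<in> elems ?K" "Q \<in> elems ?K" "R \<in> elems ?K"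
  proof -
    obtain f g h where f: "f \<in> cauchy_seqs H" "P = cl f" and g: "g \<in> cauchy_seqs H" "Q = cl g"
      and h: "h \<in> cauchy_seqs H" "R = cl h"
      using PQR by (auto simp: elems_completion)
    show ?thesis
      unfolding f g h add_cl[OF f(1) g(1)]
      by (rule ip_cl_eqI[OF cauchy_add[OF f(1) g(1)] h(1)])
        (use tendsto_add[OF ip_cl_tendsto[OF f(1) h(1)] ip_cl_tendsto[OF g(1) h(1)]] f g h
          in \<open>simp add: ip_add_left cauchyD\<close>)
  qed
  show "ip ?K (scale ?K c P) R = c * ip ?K P R" if PR: "P \<in> elems ?K" "R \<in> elems ?K"
  proof -
    obtain f h where f: "f \<in> cauchy_seqs H" "P = cl f" and h: "h \<in> cauchy_seqs H" "R = cl h"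
      using PR by (auto simp: elems_completion)
    show ?thesis
      unfolding f h scale_cl[OF f(1)]
      by (rule ip_cl_eqI[OF cauchy_scale[OF f(1)] h(1)])
        (use tendsto_mult_left[OF ip_cl_tendsto[OF f(1) h(1)]] f h
          in \<open>simp add: ip_scale_left cauchyD\<close>)
  qed
  show "0 \<le> ip ?K P P" if "P \<in> elems ?K"
  proof -
    obtain f where f: "f \<in> cauchy_seqs H" "P = cl f"
      using \<open>P \<in> elems ?K\<close> by (auto simp: elems_completion)
    show ?thesis
      unfolding f by (rule tendsto_lowerbound[OF ip_cl_tendsto[OF f(1) f(1)]])
        (auto intro!: always_eventually ip_nonneg cauchyD f)
  qed
  show "P = Q" if PQ: "P \<in> elems ?K" "Q \<in> elems ?K"
    and 0: "ip ?K (diff ?K P Q) (diff ?K P Q) = 0"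
  proof -
    obtain f g where f: "f \<in> cauchy_seqs H" "P = cl f" and g: "g \<in> cauchy_seqs H" "Q = cl g"
      using PQ by (auto simp: elems_completion)
    have "(\<lambda>n. ip H (diff H (f n) (g n)) (diff H (f n) (g n))) \<longlonglongrightarrow> 0"
      using ip_cl_tendsto[OF cauchy_diff[OF f(1) g(1)] cauchy_diff[OF f(1) g(1)]] 0
      by (simp add: f g diff_cl)
    from tendsto_real_sqrt[OF this] show ?thesis
      by (simp add: f g cl_eq_iff ip_norm_def)
  qed
qed

section \<open>Orthogonal projection onto the completion of a subspace\<close>

locale semi_ip_subspace = semi_ip_space +
  fixes V0 :: "'a set"
  assumes sub: "V0 \<subseteq> elems H" and nonempty: "V0 \<noteq> {}"
    and sub_add: "u \<in> V0 \<Longrightarrow> v \<in> V0 \<Longrightarrow> add H u v \<in> V0"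
    and sub_scale: "u \<in> V0 \<Longrightarrow> scale H c u \<in> V0"
begin

lemma sub_diff: "u \<in> V0 \<Longrightarrow> v \<in> V0 \<Longrightarrow> diff H u v \<in> V0"
  by (simp add: diff_def sub_add sub_scale)

text \<open>
  \<open>V0\<close> may be incomplete, so that its distance to \<open>f\<close> may not be attained. But if \<open>g\<close> attains the
  squared distance up to \<open>e\<^sup>2\<close>, then the quadratic polynomial
  \<open>e\<^sup>2 - 2 t (f - g, h) + t\<^sup>2 (h, h)\<close> in \<open>t\<close> is nonnegative, and its discriminant gives the bound.
\<close>

lemma almost_projection:
  assumes f: "f \<in> elems H" and e: "e > 0"
  obtains g where "g \<in> V0" "\<And>h. h \<in> V0 \<Longrightarrow> \<bar>ip H (diff H f g) h\<bar> \<le> e * N h"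
proof -
  let ?D = "(\<lambda>g. (N (diff H f g))\<^sup>2) ` V0"
  have bdd: "bdd_below ?D" by (rule bdd_belowI[of _ 0]) auto
  have "Inf ?D < Inf ?D + e\<^sup>2" using e by simp
  then obtain g where g: "g \<in> V0" "(N (diff H f g))\<^sup>2 < Inf ?D + e\<^sup>2"
    using cInf_lessD[of ?D] nonempty by blast
  show thesis
  proof (rule that[OF g(1)])
    fix h assume h: "h \<in> V0"
    have in_H: "g \<in> elems H" "h \<in> elems H" using g h sub by auto
    have "(ip H (diff H f g) h)\<^sup>2 \<le> e\<^sup>2 * ip H h h"
    proof (rule discriminant_bound)
      fix t
      have "(N (diff H f g))\<^sup>2 - e\<^sup>2 \<le> Inf ?D" using g(2) by simp
      also have "\<dots> \<le> (N (diff H f (add H g (scale H t h))))\<^sup>2"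
        by (rule cINF_lower[OF bdd]) (intro sub_add sub_scale g h)
      also have "\<dots> = (N (diff H f g))\<^sup>2 - 2 * t * ip H (diff H f g) h + t\<^sup>2 * ip H h h"
        using f in_H ip_commute[of f h] ip_commute[of f g] ip_commute[of g h]
        by (simp add: norm_sq ip_expand) (simp add: algebra_simps power2_eq_square)
      finally show "0 \<le> e\<^sup>2 - 2 * t * ip H (diff H f g) h + t\<^sup>2 * ip H h h" by simp
    qed (simp add: ip_nonneg in_H)
    also have "\<dots> = (e * N h)\<^sup>2" by (simp add: norm_sq power_mult_distrib in_H)
    finally show "\<bar>ip H (diff H f g) h\<bar> \<le> e * N h"
      by (metis abs_le_square_iff abs_of_nonneg e in_H(2) less_imp_le mult_nonneg_nonneg norm_nonneg)
  qed
qed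

abbreviation M where "M \<equiv> sub_completion H (H\<lparr>elems := V0\<rparr>)"

lemma cauchy_seqs_sub: "cauchy_seqs (H\<lparr>elems := V0\<rparr>) = {f \<in> cauchy_seqs H. \<forall>n. f n \<in> V0}"
  using sub by (auto simp: cauchy_seqs_def diff_def ip_norm_def)

text \<open>
  A class of Cauchy sequences in \<open>V0\<close> and the larger class in \<open>H\<close> that it generates have the same
  representatives in \<open>V0\<close>, so that computations with \<open>M\<close> can be done on such representatives.
\<close>

lemma M_eq: "M = cl ` {f \<in> cauchy_seqs H. \<forall>n. f n \<in> V0}"
proof -
  let ?H0 = "H\<lparr>elems := V0\<rparr>"
  have "cauchy_rel H `` (cauchy_rel ?H0 `` {f}) = cl f"
    if f: "f \<in> cauchy_seqs H" "\<forall>n. f n \<in> V0" for f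
  proof -
    have sub_rel: "cauchy_rel ?H0 \<subseteq> cauchy_rel H"
      using cauchy_seqs_sub by (auto simp: cauchy_rel_def diff_def ip_norm_def)
    have refl0: "(f, f) \<in> cauchy_rel ?H0"
      using f mem_cl[of f] cauchy_seqs_sub by (auto simp: cauchy_rel_def diff_def ip_norm_def)
    have "trans (cauchy_rel H)" using equiv_cauchy_rel by (simp add: equiv_def)
    then have "cauchy_rel H `` (cauchy_rel ?H0 `` {f}) \<subseteq> cl f"
      using sub_rel by (auto dest: transD)
    moreover have "cl f \<subseteq> cauchy_rel H `` (cauchy_rel ?H0 `` {f})"
      using refl0 by blast
    ultimately show ?thesis by blast
  qed
  then show ?thesis
    unfolding sub_completion_def hilbert_completion_def quotient_def cauchy_seqs_sub
    by (force simp: image_iff)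
qed

text \<open>
  Almost-projections \<open>g n\<close> of the members \<open>f n\<close> of a Cauchy sequence, with errors tending to \<open>0\<close>,
  form a Cauchy sequence again: testing almost orthogonality with \<open>h = g m - g n\<close> bounds the norm of
  \<open>h\<close> by that of \<open>f m - f n\<close> up to the errors. The class of \<open>g\<close> is the projection of the class of \<open>f\<close>.
\<close>

lemma projection_completion:
  assumes P: "P \<in> elems (hilbert_completion H)"
  shows "\<exists>Q\<in>M. \<forall>R\<in>M.
    ip (hilbert_completion H) (diff (hilbert_completion H) P Q) R = 0"
proof -
  obtain f where f: "f \<in> cauchy_seqs H" "P = cl f"
    using P by (auto simp: elems_completion)
  define e :: "nat \<Rightarrow> real" where "e n = inverse (real (Suc n))" for n
  have e_pos: "e n > 0" for n by (simp add: e_def)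
  have e_lim: "e \<longlonglongrightarrow> 0" unfolding e_def by (rule LIMSEQ_inverse_real_of_nat)
  have "\<exists>g. g \<in> V0 \<and> (\<forall>h\<in>V0. \<bar>ip H (diff H (f n) g) h\<bar> \<le> e n * N h)" for n
    using almost_projection[OF cauchyD[OF f(1), of n] e_pos[of n]] by metis
  then obtain g where g: "\<And>n. g n \<in> V0"
      "\<And>n h. h \<in> V0 \<Longrightarrow> \<bar>ip H (diff H (f n) (g n)) h\<bar> \<le> e n * N h"
    by metis
  have in_H: "f n \<in> elems H" "g n \<in> elems H" for n
    using f g sub cauchyD by auto
  have bound: "N (diff H (g m) (g n)) \<le> N (diff H (f m) (f n)) + e m + e n" for m n
  proof -
    let ?h = "diff H (g m) (g n)" and ?k = "diff H (f m) (f n)"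
    have h: "?h \<in> V0" "?h \<in> elems H" "?k \<in> elems H"
      using g sub_diff closed in_H by auto
    have "(N ?h)\<^sup>2 = ip H ?k ?h - ip H (diff H (f m) (g m)) ?h + ip H (diff H (f n) (g n)) ?h"
      using in_H by (simp add: norm_sq ip_expand)
    also have "\<dots> \<le> N ?k * N ?h + e m * N ?h + e n * N ?h"
      using Cauchy_Schwarz[OF h(3,2)] g(2)[OF h(1), of m] g(2)[OF h(1), of n] by linarith
    finally have "N ?h * N ?h \<le> (N ?k + e m + e n) * N ?h"
      by (simp add: algebra_simps power2_eq_square)
    moreover have "0 \<le> N ?k + e m + e n"
      using norm_nonneg[OF h(3)] e_pos[of m] e_pos[of n] by simp
    ultimately show ?thesis
      using norm_nonneg[OF h(2)] by (cases "N ?h = 0") (auto simp: mult_le_cancel_right)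
  qed
  have g_cauchy: "g \<in> cauchy_seqs H"
  proof (rule cauchyI)
    fix d :: real assume "d > 0"
    then have "d / 3 > 0" by simp
    obtain M1 where M1: "\<And>m n. m \<ge> M1 \<Longrightarrow> n \<ge> M1 \<Longrightarrow> N (diff H (f m) (f n)) < d / 3"
      using cauchyE[OF f(1) \<open>d / 3 > 0\<close>] by blast
    obtain M2 where M2: "\<And>n. n \<ge> M2 \<Longrightarrow> e n < d / 3"
      using order_tendstoD(2)[OF e_lim \<open>d / 3 > 0\<close>] by (auto simp: eventually_sequentially)
    have "N (diff H (g m) (g n)) < d" if "m \<ge> max M1 M2" "n \<ge> max M1 M2" for m n
    proof -
      have "N (diff H (f m) (f n)) < d / 3" "e m < d / 3" "e n < d / 3"
        using that M1[of m n] M2[of m] M2[of n] by auto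
      then show ?thesis using bound[of m n] by linarith
    qed
    then show "\<exists>M. \<forall>m\<ge>M. \<forall>n\<ge>M. N (diff H (g m) (g n)) < d" by blast
  qed (rule in_H)
  show ?thesis
  proof (rule bexI[of _ "cl g"], rule ballI)
    fix R assume "R \<in> M"
    then obtain h where h: "h \<in> cauchy_seqs H" "\<And>n. h n \<in> V0" "R = cl h"
      by (auto simp: M_eq)
    obtain l where l: "(\<lambda>n. N (h n)) \<longlonglongrightarrow> l"
      using norm_convergent[OF h(1)] by (auto simp: convergent_def)
    have "(\<lambda>n. e n * N (h n)) \<longlonglongrightarrow> 0"
      using tendsto_mult[OF e_lim l] by simp
    then have "(\<lambda>n. ip H (diff H (f n) (g n)) (h n)) \<longlonglongrightarrow> 0"
      by (rule Lim_null_comparison[rotated]) (simp add: g(2) h(2))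
    then show "ip (hilbert_completion H) (diff (hilbert_completion H) P (cl g)) R = 0"
      unfolding f h diff_cl[OF f(1) g_cauchy]
      by (rule ip_cl_eqI[OF cauchy_diff[OF f(1) g_cauchy] h(1)])
  next
    show "cl g \<in> M" using g g_cauchy by (auto simp: M_eq)
  qed
qed

end

section \<open>Quotients by subspaces that admit orthogonal projections\<close>

text \<open>
  The existence of projections is an assumption here: it takes the place of completeness of the space
  and closedness of \<open>M\<close>.
\<close>

locale ip_projection_space = ip_space +
  fixes M :: "'a set"
  assumes sub: "M \<subseteq> elems H" and nonempty: "M \<noteq> {}"
    and sub_add: "u \<in> M \<Longrightarrow> v \<in> M \<Longrightarrow> add H u v \<in> M"
    and sub_scale: "u \<in> M \<Longrightarrow> scale H c u \<in> M"
    and projection: "u \<in> elems H \<Longrightarrow> \<exists>m\<in>M. \<forall>h\<in>M. ip H (diff H u m) h = 0"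
begin

lemma mem_elems: "u \<in> M \<Longrightarrow> u \<in> elems H"
  using sub by blast

lemma sub_diff: "u \<in> M \<Longrightarrow> v \<in> M \<Longrightarrow> diff H u v \<in> M"
  by (simp add: diff_def sub_add sub_scale)

lemma coset_self: "u \<in> elems H \<Longrightarrow> u \<in> coset H M u"
proof -
  assume u: "u \<in> elems H"
  obtain m where m: "m \<in> M" using nonempty by blast
  have "diff H u u = scale H 0 m"
    by (rule definite) (use u m mem_elems in \<open>auto simp: ip_expand\<close>)
  with u m show ?thesis by (simp add: coset_def sub_scale)
qed

lemma coset_eq:
  assumes u: "u \<in> elems H" and v: "v \<in> coset H M u"
  shows "coset H M v = coset H M u"
proof -
  have v': "v \<in> elems H" "diff H v u \<in> M" using v by (auto simp: coset_def)
  have "diff H x u \<in> M" if x: "x \<in> elems H" "diff H x v \<in> M" for x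
  proof -
    have "diff H x u = add H (diff H x v) (diff H v u)"
      by (rule definite) (use u v' x in \<open>auto simp: ip_expand\<close>)
    with x v' sub_add show ?thesis by simp
  qed
  moreover have "diff H x v \<in> M" if x: "x \<in> elems H" "diff H x u \<in> M" for x
  proof -
    have "diff H x v = diff H (diff H x u) (diff H v u)"
      by (rule definite) (use u v' x in \<open>auto simp: ip_expand\<close>)
    with x v' sub_diff show ?thesis by simp
  qed
  ultimately show ?thesis unfolding coset_def by blast
qed

abbreviation X where "X \<equiv> quotient_space H M"

lemma add_coset:
  assumes u: "u \<in> elems H" and v: "v \<in> elems H"
  shows "add X (coset H M u) (coset H M v) = coset H M (add H u v)"
proof -
  have eq: "coset H M (add H u' v') = coset H M (add H u v)"
    if u': "u' \<in> coset H M u" and v': "v' \<in> coset H M v" for u' v'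
  proof (rule coset_eq)
    have D: "u' \<in> elems H" "diff H u' u \<in> M" "v' \<in> elems H" "diff H v' v \<in> M"
      using u' v' by (auto simp: coset_def)
    have "diff H (add H u' v') (add H u v) = add H (diff H u' u) (diff H v' v)"
      by (rule definite) (use u v D in \<open>auto simp: ip_expand\<close>)
    with D show "add H u' v' \<in> coset H M (add H u v)"
      by (simp add: coset_def sub_add closed)
  qed (use u v closed in blast)
  have "(\<Union>u'\<in>coset H M u. \<Union>v'\<in>coset H M v. coset H M (add H u' v')) = coset H M (add H u v)"
  proof (intro SUP_eq_const)
    show "coset H M u \<noteq> {}" "coset H M v \<noteq> {}" using coset_self u v by blast+
  qed (rule eq, simp_all)
  then show ?thesis by (simp add: quotient_space_def)
qed

lemma scale_coset:
  assumes u: "u \<in> elems H"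
  shows "scale X c (coset H M u) = coset H M (scale H c u)"
proof -
  have eq: "coset H M (scale H c u') = coset H M (scale H c u)" if u': "u' \<in> coset H M u" for u'
  proof (rule coset_eq)
    have D: "u' \<in> elems H" "diff H u' u \<in> M"
      using u' by (auto simp: coset_def)
    have "diff H (scale H c u') (scale H c u) = scale H c (diff H u' u)"
      by (rule definite) (use u D in \<open>auto simp: ip_expand algebra_simps\<close>)
    with D show "scale H c u' \<in> coset H M (scale H c u)"
      by (simp add: coset_def sub_scale closed)
  qed (use u closed in blast)
  have "(\<Union>u'\<in>coset H M u. coset H M (scale H c u')) = coset H M (scale H c u)"
  proof (intro SUP_eq_const)
    show "coset H M u \<noteq> {}" using coset_self u by blast
  qed (rule eq, simp_all)
  then show ?thesis by (simp add: quotient_space_def)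
qed

lemma elems_X: "elems X = coset H M ` elems H"
  by (simp add: quotient_space_def)

abbreviation minimiser where
  "minimiser v \<equiv> THE u. is_arg_min (\<lambda>u. 1 / 2 * (ip_norm H u)\<^sup>2)
                                   (\<lambda>u. u \<in> elems H \<and> coset H M u = v) u"

text \<open>
  By Pythagoras, the residue \<open>u - m\<close> of the orthogonal projection is the one element of least norm
  in the coset.
\<close>

lemma minimiser_orthogonal:
  assumes v: "v \<in> elems X"
  shows "minimiser v \<in> elems H \<and> (\<forall>h\<in>M. ip H (minimiser v) h = 0)"
proof -
  obtain u where u: "u \<in> elems H" "v = coset H M u" using v by (auto simp: elems_X)
  obtain m where m: "m \<in> M" "\<forall>h\<in>M. ip H (diff H u m) h = 0" using projection[OF u(1)] by blast
  define S where "S = diff H u m"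
  have S: "S \<in> elems H" using u m mem_elems closed by (simp add: S_def)
  have orth: "\<forall>h\<in>M. ip H S h = 0" using m by (simp add: S_def)
  have "diff H S u = scale H (- 1) m"
    by (rule definite) (use u m mem_elems in \<open>auto simp: S_def ip_expand\<close>)
  with S m have S_u: "S \<in> coset H M u" by (simp add: coset_def sub_scale)
  then have S_v: "coset H M S = v" using coset_eq u by simp
  let ?F = "\<lambda>u. 1 / 2 * (ip_norm H u)\<^sup>2"
  let ?C = "\<lambda>u. u \<in> elems H \<and> coset H M u = v"
  have pyth: "(N x)\<^sup>2 = (N S)\<^sup>2 + ip H (diff H x S) (diff H x S)" if x: "?C x" for x
  proof -
    have "diff H x S \<in> M" using coset_self[of x] x S_v by (auto simp: coset_def)
    then have "ip H S (diff H x S) = 0" using orth by blast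
    then have "ip H S x = ip H S S" using S x by (simp add: ip_expand)
    then show ?thesis using S x ip_commute[of x S] by (simp add: norm_sq ip_expand)
  qed
  have "is_arg_min ?F ?C S"
    unfolding is_arg_min_def
  proof (intro conjI notI)
    assume "\<exists>y. ?C y \<and> ?F y < ?F S"
    then obtain y where y: "?C y" "?F y < ?F S" by blast
    with pyth[OF y(1)] ip_nonneg[of "diff H y S"] S closed show False by auto
  qed (use S S_v in simp_all)
  moreover have "x = S" if x: "is_arg_min ?F ?C x" for x
  proof -
    have C: "?C x" using x by (simp add: is_arg_min_def)
    have "\<not> ?F S < ?F x" using x S S_v by (auto simp: is_arg_min_def)
    with pyth[OF C] ip_nonneg[of "diff H x S"] S C closed
    have "ip H (diff H x S) (diff H x S) = 0" by force
    then show ?thesis using definite C S by blast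
  qed
  ultimately have "minimiser v = S" by (rule the_equality)
  with S orth show ?thesis by simp
qed

text \<open>
  The minimiser is orthogonal to \<open>M\<close>, so that pairing with it is constant on cosets; Cauchy-Schwarz,
  applied to all representatives of a coset, gives the bound by the quotient norm. Uniqueness holds
  because the quotient map is onto.
\<close>

theorem unique_functional_of_minimiser:
  assumes v: "v \<in> elems X"
  shows "\<exists>!l. l \<in> dual X \<and> (\<forall>\<psi>\<in>elems H. l (coset H M \<psi>) = ip H (minimiser v) \<psi>)"
proof -
  define S where "S = minimiser v"
  have S: "S \<in> elems H" and orth: "\<And>h. h \<in> M \<Longrightarrow> ip H S h = 0"
    using minimiser_orthogonal[OF v] by (auto simp: S_def)
  have const: "ip H S x = ip H S u" if "u \<in> elems H" "x \<in> coset H M u" for u x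
    using that orth[of "diff H x u"] S by (auto simp: coset_def ip_diff_right)
  \<comment> \<open>The choice of representative is immaterial by \<open>const\<close>.\<close>
  define l where "l = (\<lambda>P\<in>elems X. ip H S (SOME x. x \<in> P))"
  have l: "l (coset H M u) = ip H S u" if u: "u \<in> elems H" for u
  proof -
    have "(SOME x. x \<in> coset H M u) \<in> coset H M u" by (rule someI, rule coset_self[OF u])
    then show ?thesis using u const by (simp add: l_def elems_X)
  qed
  have bounded: "\<bar>l P\<bar> \<le> N S * nrm X P" if P: "P \<in> elems X" for P
  proof -
    obtain u where u: "u \<in> elems H" "P = coset H M u" using P by (auto simp: elems_X)
    have le: "\<bar>l P\<bar> \<le> N S * N x" if x: "x \<in> P" for x
    proof -
      have "x \<in> elems H" using x u by (simp add: coset_def)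
      then show ?thesis using l[OF u(1)] const[OF u(1), of x] x u Cauchy_Schwarz[OF S, of x] by simp
    qed
    have nrm: "nrm X P = (INF x\<in>P. N x)" by (simp add: quotient_space_def)
    show ?thesis
    proof (cases "N S = 0")
      case True
      with le[of u] u coset_self show ?thesis by simp
    next
      case False
      then have pos: "N S > 0" using norm_nonneg[OF S] by simp
      have "\<bar>l P\<bar> / N S \<le> (INF x\<in>P. N x)"
        by (rule cINF_greatest) (use le pos u coset_self in \<open>auto simp: field_simps\<close>)
      then show ?thesis using pos nrm by (simp add: field_simps)
    qed
  qed
  have "l \<in> dual X"
    unfolding dual_def
  proof (intro CollectI conjI ballI allI)
    show "l \<in> extensional (elems X)" by (simp add: l_def)
    show "\<exists>K. \<forall>u\<in>elems X. \<bar>l u\<bar> \<le> K * nrm X u" using bounded by blast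
  next
    fix P Q assume "P \<in> elems X" "Q \<in> elems X"
    then show "l (add X P Q) = l P + l Q"
      using S by (auto simp: elems_X add_coset l closed ip_add_right)
  next
    fix c P assume "P \<in> elems X"
    then show "l (scale X c P) = c * l P"
      using S by (auto simp: elems_X scale_coset l closed ip_scale_right)
  qed
  moreover have "l' = l"
    if "l' \<in> dual X" "\<forall>\<psi>\<in>elems H. l' (coset H M \<psi>) = ip H S \<psi>" for l'
  proof (rule extensionalityI)
    show "l' \<in> extensional (elems X)" "l \<in> extensional (elems X)"
      using that \<open>l \<in> dual X\<close> by (auto simp: dual_def)
  qed (use that l in \<open>auto simp: elems_X\<close>)
  ultimately show ?thesis using l unfolding S_def by blast
qed

end

lemma (in semi_ip_subspace) ip_projection_space_completion:
  "ip_projection_space (hilbert_completion H) M"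
proof -
  interpret K: ip_space "hilbert_completion H" by (rule ip_space_completion)
  show ?thesis
  proof
    show "M \<subseteq> elems (hilbert_completion H)" by (auto simp: M_eq elems_completion)
    show "M \<noteq> {}"
    proof -
      obtain u where "u \<in> V0" using nonempty by blast
      then show ?thesis using cauchy_const[of u] sub by (auto simp: M_eq)
    qed
    show "add (hilbert_completion H) P Q \<in> M" if "P \<in> M" "Q \<in> M" for P Q
      using that by (auto simp: M_eq add_cl intro!: imageI cauchy_add sub_add)
    show "scale (hilbert_completion H) c P \<in> M" if "P \<in> M" for P c
      using that by (auto simp: M_eq scale_cl intro!: imageI cauchy_scale sub_scale)
  qed (rule projection_completion)
qed

section \<open>Functions with continuous partial derivatives\<close>

lemma has_derivative_frechet:
  assumes "open U" "f differentiable_on U" "x \<in> U"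
  shows "(f has_derivative frechet_derivative f (at x)) (at x)"
  using assms by (simp add: differentiable_on_eq_differentiable_at flip: frechet_derivative_works)

text \<open>
  Partial derivatives enter the definition through the Frechet derivative of the very function at
  hand, so that congruence under equality on an open set comes first.
\<close>

lemma C_on_cong:
  assumes "open U"
  shows "(\<And>x. x \<in> U \<Longrightarrow> f x = g x) \<Longrightarrow> C_on k U f \<Longrightarrow> C_on k U g"
proof (induction k arbitrary: f g)
  case 0
  then show ?case using continuous_on_cong[of U U f g] by simp
next
  case (Suc k)
  have D: "(g has_derivative frechet_derivative f (at x)) (at x)" if "x \<in> U" for x
    using has_derivative_frechet[OF assms _ that, of f] Suc.prems that
    by (auto intro: has_derivative_transform_within_open[OF _ assms])
  then have "g differentiable_on U"
    using assms by (auto simp: differentiable_on_eq_differentiable_at differentiable_def)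
  moreover have "C_on k U (\<lambda>x. frechet_derivative g (at x) b)" if b: "b \<in> Basis" for b
  proof (rule Suc.IH)
    show "C_on k U (\<lambda>x. frechet_derivative f (at x) b)" using Suc.prems b by simp
    show "frechet_derivative f (at x) b = frechet_derivative g (at x) b" if "x \<in> U" for x
      using frechet_derivative_at[OF D[OF that]] by simp
  qed
  ultimately show ?case by simp
qed

lemma C_on_SucI:
  assumes U: "open U" and D: "\<And>x. x \<in> U \<Longrightarrow> (f has_derivative f' x) (at x)"
    and C: "\<And>b. b \<in> Basis \<Longrightarrow> C_on k U (\<lambda>x. f' x b)"
  shows "C_on (Suc k) U f"
proof -
  have "f differentiable_on U"
    using assms by (auto simp: differentiable_on_eq_differentiable_at differentiable_def)
  moreover have "C_on k U (\<lambda>x. frechet_derivative f (at x) b)" if b: "b \<in> Basis" for b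
    by (rule C_on_cong[OF U _ C[OF b]]) (simp add: frechet_derivative_at[OF D, symmetric])
  ultimately show ?thesis by simp
qed

lemma C_on_Suc_imp: "C_on (Suc k) U f \<Longrightarrow> C_on k U f"
proof (induction k arbitrary: f)
  case 0
  then show ?case by (simp add: differentiable_imp_continuous_on)
next
  case (Suc k)
  then have "f differentiable_on U" by simp
  moreover have "C_on k U (\<lambda>x. frechet_derivative f (at x) b)" if "b \<in> Basis" for b
    using Suc.prems that by (intro Suc.IH) simp
  ultimately show ?case by simp
qed

lemma C_on_imp_continuous: "C_on k U f \<Longrightarrow> continuous_on U f"
  by (cases k) (auto simp: differentiable_imp_continuous_on)

lemma C_on_const: "C_on k U (\<lambda>x. c)"
proof (induction k arbitrary: c)
  case (Suc k)
  have "frechet_derivative (\<lambda>x::'a. c) (at x) = (\<lambda>_. 0)" for x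
    by (rule frechet_derivative_at[symmetric]) simp
  with Suc show ?case by simp
qed simp

lemma C_on_add:
  assumes "open U"
  shows "C_on k U f \<Longrightarrow> C_on k U g \<Longrightarrow> C_on k U (\<lambda>x. f x + g x)"
proof (induction k arbitrary: f g)
  case (Suc k)
  show ?case
  proof (rule C_on_SucI[OF assms])
    show "((\<lambda>x. f x + g x) has_derivative
        (\<lambda>h. frechet_derivative f (at x) h + frechet_derivative g (at x) h)) (at x)" if "x \<in> U" for x
      using Suc.prems by (intro has_derivative_add has_derivative_frechet[OF assms _ that]) auto
  qed (use Suc in simp)
qed (simp add: continuous_on_add)

lemma C_on_mult:
  assumes "open U"
  shows "C_on k U f \<Longrightarrow> C_on k U g \<Longrightarrow> C_on k U (\<lambda>x. f x * g x)"
proof (induction k arbitrary: f g)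
  case (Suc k)
  show ?case
  proof (rule C_on_SucI[OF assms])
    show "((\<lambda>x. f x * g x) has_derivative
        (\<lambda>h. f x * frechet_derivative g (at x) h + frechet_derivative f (at x) h * g x)) (at x)"
      if "x \<in> U" for x
      using Suc.prems by (intro has_derivative_mult has_derivative_frechet[OF assms _ that]) auto
    show "C_on k U (\<lambda>x. f x * frechet_derivative g (at x) b + frechet_derivative f (at x) b * g x)"
      if "b \<in> Basis" for b
      using Suc.prems that C_on_Suc_imp[OF Suc.prems(1)] C_on_Suc_imp[OF Suc.prems(2)]
      by (intro C_on_add assms Suc.IH) simp_all
  qed
qed (simp add: continuous_on_mult)

lemma C_on_prod:
  assumes "open U" "finite I" "\<And>i. i \<in> I \<Longrightarrow> C_on k U (f i)"
  shows "C_on k U (\<lambda>x. \<Prod>i\<in>I. f i x)"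
  using assms(2,3) by (induction I) (auto intro: C_on_const C_on_mult assms(1))

lemma extends_to_closure_add:
  assumes "extends_to_closure U f" "extends_to_closure U g"
  shows "extends_to_closure U (\<lambda>x. f x + g x)"
proof -
  obtain f' where "continuous_on (closure U) f'" "\<forall>x\<in>U. f' x = f x"
    using assms(1) by (auto simp: extends_to_closure_def)
  moreover obtain g' where "continuous_on (closure U) g'" "\<forall>x\<in>U. g' x = g x"
    using assms(2) by (auto simp: extends_to_closure_def)
  ultimately show ?thesis
    unfolding extends_to_closure_def by (intro exI[of _ "\<lambda>x. f' x + g' x"]) (simp add: continuous_on_add)
qed

lemma extends_to_closure_scale:
  assumes "extends_to_closure U f"
  shows "extends_to_closure U (\<lambda>x. c * f x)"
proof -
  obtain f' where "continuous_on (closure U) f'" "\<forall>x\<in>U. f' x = f x"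
    using assms by (auto simp: extends_to_closure_def)
  then show ?thesis
    unfolding extends_to_closure_def
    by (intro exI[of _ "\<lambda>x. c * f' x"]) (simp add: continuous_on_mult_left)
qed

lemma extends_to_closure_cong:
  "(\<And>x. x \<in> U \<Longrightarrow> f x = g x) \<Longrightarrow> extends_to_closure U f \<Longrightarrow> extends_to_closure U g"
  by (simp add: extends_to_closure_def)

lemma C_upto_bdry_cong:
  assumes "open U"
  shows "(\<And>x. x \<in> U \<Longrightarrow> f x = g x) \<Longrightarrow> C_upto_bdry k U f \<Longrightarrow> C_upto_bdry k U g"
proof (induction k arbitrary: f g)
  case 0
  then show ?case using extends_to_closure_cong[of U f g] by simp
next
  case (Suc k)
  have D: "(g has_derivative frechet_derivative f (at x)) (at x)" if "x \<in> U" for x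
    using has_derivative_frechet[OF assms _ that, of f] Suc.prems that
    by (auto intro: has_derivative_transform_within_open[OF _ assms])
  then have "g differentiable_on U"
    using assms by (auto simp: differentiable_on_eq_differentiable_at differentiable_def)
  moreover have "extends_to_closure U g"
    using Suc.prems extends_to_closure_cong[of U f g] by simp
  moreover have "C_upto_bdry k U (\<lambda>x. frechet_derivative g (at x) b)" if b: "b \<in> Basis" for b
  proof (rule Suc.IH)
    show "C_upto_bdry k U (\<lambda>x. frechet_derivative f (at x) b)" using Suc.prems b by simp
    show "frechet_derivative f (at x) b = frechet_derivative g (at x) b" if "x \<in> U" for x
      using frechet_derivative_at[OF D[OF that]] by simp
  qed
  ultimately show ?case by simp
qed

lemma C_upto_bdry_SucI:
  assumes U: "open U" and D: "\<And>x. x \<in> U \<Longrightarrow> (f has_derivative f' x) (at x)"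
    and C: "\<And>b. b \<in> Basis \<Longrightarrow> C_upto_bdry k U (\<lambda>x. f' x b)"
    and E: "extends_to_closure U f"
  shows "C_upto_bdry (Suc k) U f"
proof -
  have "f differentiable_on U"
    using assms by (auto simp: differentiable_on_eq_differentiable_at differentiable_def)
  moreover have "C_upto_bdry k U (\<lambda>x. frechet_derivative f (at x) b)" if b: "b \<in> Basis" for b
    by (rule C_upto_bdry_cong[OF U _ C[OF b]]) (simp add: frechet_derivative_at[OF D, symmetric])
  ultimately show ?thesis using E by simp
qed

lemma C_upto_bdry_add:
  assumes "open U"
  shows "C_upto_bdry k U f \<Longrightarrow> C_upto_bdry k U g \<Longrightarrow> C_upto_bdry k U (\<lambda>x. f x + g x)"
proof (induction k arbitrary: f g)
  case (Suc k)
  show ?case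
  proof (rule C_upto_bdry_SucI[OF assms])
    show "((\<lambda>x. f x + g x) has_derivative
        (\<lambda>h. frechet_derivative f (at x) h + frechet_derivative g (at x) h)) (at x)" if "x \<in> U" for x
      using Suc.prems by (intro has_derivative_add has_derivative_frechet[OF assms _ that]) auto
  qed (use Suc in \<open>simp_all add: extends_to_closure_add\<close>)
qed (simp add: extends_to_closure_add)

lemma C_upto_bdry_scale:
  assumes "open U"
  shows "C_upto_bdry k U f \<Longrightarrow> C_upto_bdry k U (\<lambda>x. c * f x)"
proof (induction k arbitrary: f)
  case (Suc k)
  show ?case
  proof (rule C_upto_bdry_SucI[OF assms])
    show "((\<lambda>x. c * f x) has_derivative (\<lambda>h. c * frechet_derivative f (at x) h)) (at x)"
      if "x \<in> U" for x
      using Suc.prems by (intro has_derivative_mult_right has_derivative_frechet[OF assms _ that]) auto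
  qed (use Suc in \<open>simp_all add: extends_to_closure_scale\<close>)
qed (simp add: extends_to_closure_scale)

lemma continuous_on_zero_extension:
  assumes "open U" "closed K" "K \<subseteq> U" "continuous_on U f" "\<And>x. x \<notin> K \<Longrightarrow> f x = 0"
  shows "continuous_on UNIV f"
proof -
  have "continuous_on (- K) f"
    using assms(5) by (subst continuous_on_cong[of _ _ _ "\<lambda>_. 0"]) auto
  then have "continuous_on (U \<union> - K) f"
    using assms by (intro continuous_on_open_Un) auto
  also have "U \<union> - K = UNIV" using assms(3) by auto
  finally show ?thesis .
qed

lemma frechet_derivative_zero_outside:
  assumes "closed K" "\<And>x. x \<notin> K \<Longrightarrow> f x = 0" "x \<notin> K"
  shows "frechet_derivative f (at x) = (\<lambda>_. 0)"
proof -
  have "(f has_derivative (\<lambda>_. 0)) (at x)"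
    by (rule has_derivative_transform_within_open[where s = "- K" and f = "\<lambda>_. 0"])
      (use assms in auto)
  then show ?thesis by (rule frechet_derivative_at[symmetric])
qed

text \<open>
  \<open>f\<close> and all its partial derivatives vanish off \<open>K\<close>, so that they are continuous on the whole space.
\<close>

lemma C_upto_bdry_compact_support:
  assumes "open U" "closed K" "K \<subseteq> U"
  shows "C_on k U f \<Longrightarrow> (\<And>x. x \<notin> K \<Longrightarrow> f x = 0) \<Longrightarrow> C_upto_bdry k U f"
proof (induction k arbitrary: f)
  case 0
  then have "continuous_on UNIV f"
    using continuous_on_zero_extension[OF assms, of f] by simp
  then show ?case by (auto simp: extends_to_closure_def intro: continuous_on_subset)
next
  case (Suc k)
  have "continuous_on UNIV f"
    using continuous_on_zero_extension[OF assms, of f] C_on_imp_continuous[OF Suc.prems(1)]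
      Suc.prems(2) by blast
  then have "extends_to_closure U f"
    by (auto simp: extends_to_closure_def intro: continuous_on_subset)
  moreover have "C_upto_bdry k U (\<lambda>x. frechet_derivative f (at x) b)" if "b \<in> Basis" for b
    by (rule Suc.IH) (use Suc.prems that frechet_derivative_zero_outside[OF assms(2), of f] in auto)
  ultimately show ?case using Suc.prems by simp
qed

section \<open>Test functions\<close>

lemma supp_subset: "closed K \<Longrightarrow> (\<And>x. x \<notin> K \<Longrightarrow> u x = 0) \<Longrightarrow> supp u \<subseteq> K"
  unfolding supp_def by (rule closure_minimal) auto

lemma zero_outside_supp: "x \<notin> supp u \<Longrightarrow> u x = 0"
  unfolding supp_def using closure_subset[of "{x. u x \<noteq> 0}"] by blast

lemma closed_supp: "closed (supp u)"
  by (simp add: supp_def)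

lemma compact_supp_subset:
  assumes "compact K" "\<And>x. x \<notin> K \<Longrightarrow> u x = 0"
  shows "compact (supp u)" "supp u \<subseteq> K"
proof -
  show "supp u \<subseteq> K" using assms by (intro supp_subset compact_imp_closed)
  then show "compact (supp u)"
    using compact_Int_closed[OF assms(1) closed_supp[of u]] by (simp add: inf.absorb2)
qed

lemma test_functionsI:
  assumes "\<And>k. C_on k U u" "compact K" "K \<subseteq> U" "\<And>x. x \<notin> K \<Longrightarrow> u x = 0"
  shows "u \<in> test_functions U"
  using assms(1,3) compact_supp_subset[of K u, OF assms(2,4)]
  by (auto simp: test_functions_def smooth_on_def)

lemma test_functions_add:
  assumes U: "open U" and u: "u \<in> test_functions U" and v: "v \<in> test_functions U"
  shows "(\<lambda>x. u x + v x) \<in> test_functions U"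
proof (rule test_functionsI)
  show "C_on k U (\<lambda>x. u x + v x)" for k
    using u v by (intro C_on_add U) (auto simp: test_functions_def smooth_on_def)
  show "compact (supp u \<union> supp v)" "supp u \<union> supp v \<subseteq> U"
    using u v by (auto simp: test_functions_def)
qed (simp_all add: zero_outside_supp)

lemma test_functions_scale:
  assumes U: "open U" and u: "u \<in> test_functions U"
  shows "(\<lambda>x. c * u x) \<in> test_functions U"
proof (rule test_functionsI)
  show "C_on k U (\<lambda>x. c * u x)" for k
    using u by (intro C_on_mult C_on_const U) (auto simp: test_functions_def smooth_on_def)
  show "compact (supp u)" "supp u \<subseteq> U"
    using u by (auto simp: test_functions_def)
qed (simp_all add: zero_outside_supp)

lemma zero_in_test_functions: "(\<lambda>x. 0) \<in> test_functions U"
  by (rule test_functionsI[of _ _ "{}"]) (auto intro: C_on_const)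

lemma test_functions_smooth_on_closure:
  assumes U: "open U" and u: "u \<in> test_functions U"
  shows "u \<in> smooth_on_closure U"
proof -
  have C: "C_on k U u" for k using u by (simp add: test_functions_def smooth_on_def)
  have S: "supp u \<subseteq> U" using u by (simp add: test_functions_def)
  have "continuous_on UNIV u"
    using continuous_on_zero_extension[OF U closed_supp S, of u] C[of 0] zero_outside_supp[of _ u] by simp
  moreover have "C_upto_bdry k U u" for k
    using C_upto_bdry_compact_support[OF U closed_supp S C] zero_outside_supp[of _ u] by simp
  ultimately show ?thesis
    by (auto simp: smooth_on_closure_def intro: continuous_on_subset)
qed

section \<open>Smooth bump functions\<close>

text \<open>
  The functions \<open>p(1/t) exp(-c/t)\<close>, extended by zero to \<open>t \<le> 0\<close>. Allowing a polynomial factor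
  makes the family closed under differentiation, which gives smoothness by induction.
\<close>

definition flat :: "real \<Rightarrow> real poly \<Rightarrow> real \<Rightarrow> real" where
  "flat c p t = (if t > 0 then poly p (1 / t) * exp (- c / t) else 0)"

lemma poly_times_exp_tendsto_0:
  fixes p :: "real poly"
  assumes "c > 0"
  shows "((\<lambda>z. poly p z * exp (- (c * z))) \<longlongrightarrow> 0) at_top"
proof -
  \<comment> \<open>The power makes the induction on \<open>p\<close> go through: the tail of \<open>p\<close> comes with one more factor \<open>z\<close>.\<close>
  have "((\<lambda>z. z ^ k * poly p z * exp (- (c * z))) \<longlongrightarrow> 0) at_top" for k
  proof (induction p arbitrary: k)
    case 0
    show ?case by simp
  next
    case (pCons a p)
    have "filterlim (\<lambda>z. c * z) at_top at_top"
      using assms by (intro filterlim_tendsto_pos_mult_at_top[OF tendsto_const _ filterlim_ident]) auto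
    then have "((\<lambda>z. (c * z) ^ k / exp (c * z)) \<longlongrightarrow> 0) at_top"
      by (rule filterlim_compose[OF tendsto_power_div_exp_0])
    then have "((\<lambda>z. (a / c ^ k) * ((c * z) ^ k / exp (c * z))) \<longlongrightarrow> 0) at_top"
      by (rule tendsto_mult_right_zero)
    moreover have "(a / c ^ k) * ((c * z) ^ k / exp (c * z)) = a * z ^ k * exp (- (c * z))" for z
      using assms by (simp add: power_mult_distrib exp_minus field_simps)
    ultimately have "((\<lambda>z. a * z ^ k * exp (- (c * z))) \<longlongrightarrow> 0) at_top" by simp
    from tendsto_add[OF this pCons.IH[of "Suc k"]] show ?case
      by (simp add: algebra_simps)
  qed
  from this[of 0] show ?thesis by simp
qed

lemma flat_tendsto_0:
  assumes "c > 0"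
  shows "((\<lambda>t. flat c p t) \<longlongrightarrow> 0) (at 0)"
proof (rule filterlim_split_at)
  show "((\<lambda>t. flat c p t) \<longlongrightarrow> 0) (at_left 0)"
    by (rule tendsto_eventually) (auto simp: flat_def eventually_at_left_field intro: exI[of _ "-1"])
  have "((\<lambda>t. poly p (inverse t) * exp (- (c * inverse t))) \<longlongrightarrow> 0) (at_right 0)"
    by (rule filterlim_compose[OF poly_times_exp_tendsto_0[OF assms] filterlim_inverse_at_top_right])
  then show "((\<lambda>t. flat c p t) \<longlongrightarrow> 0) (at_right 0)"
    by (rule Lim_transform_eventually)
      (auto simp: flat_def eventually_at_right_field field_simps intro: exI[of _ 1])
qed

lemma DERIV_flat:
  assumes "c > 0"
  shows "(flat c p has_real_derivative flat c ([:0, 0, 1:] * (smult c p - pderiv p)) t) (at t)"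
proof (cases t "0::real" rule: linorder_cases)
  case less
  have "((\<lambda>_. 0) has_real_derivative 0) (at t)" by simp
  then have "(flat c p has_real_derivative 0) (at t)"
    by (rule has_field_derivative_transform_within_open[where S = "{..<0}"])
      (use less in \<open>auto simp: flat_def\<close>)
  with less show ?thesis by (simp add: flat_def)
next
  case equal
  \<comment> \<open>Dividing by \<open>h\<close> amounts to multiplying \<open>p\<close> by its variable, hence stays within the family.\<close>
  have "((\<lambda>h. flat c (pCons 0 p) h) \<longlongrightarrow> 0) (at 0)"
    by (rule flat_tendsto_0[OF assms])
  moreover have "flat c (pCons 0 p) h = (flat c p h - flat c p 0) / (h - 0)" for h
    by (simp add: flat_def)
  ultimately show ?thesis
    using equal by (simp add: has_field_derivative_iff) (simp add: flat_def)
next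
  case greater
  have "((\<lambda>t. poly p (1 / t) * exp (- c / t)) has_real_derivative
      flat c ([:0, 0, 1:] * (smult c p - pderiv p)) t) (at t)"
    using greater by (auto intro!: derivative_eq_intros poly_DERIV[THEN DERIV_chain2]
        simp: flat_def field_simps power2_eq_square)
  then show ?thesis
    by (rule has_field_derivative_transform_within_open[where S = "{0<..}"])
      (use greater in \<open>auto simp: flat_def\<close>)
qed

lemma C_on_flat:
  fixes v :: "'e::euclidean_space"
  assumes "c > 0" "open U"
  shows "C_on k U (\<lambda>x. flat c p (x \<bullet> v + a))"
proof (induction k arbitrary: p)
  have D: "((\<lambda>x. flat c p (x \<bullet> v + a)) has_derivative
      (\<lambda>h. (h \<bullet> v) * flat c ([:0, 0, 1:] * (smult c p - pderiv p)) (x \<bullet> v + a))) (at x)" for x p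
    by (rule DERIV_compose_FDERIV[OF DERIV_flat[OF assms(1)]]) (auto intro!: derivative_eq_intros)
  {
    case 0
    show ?case using has_derivative_continuous[OF D[of p]]
      by (simp add: continuous_at_imp_continuous_on)
  next
    case (Suc k)
    show ?case
      by (rule C_on_SucI[OF assms(2) D]) (intro C_on_mult C_on_const assms Suc.IH)
  }
qed

definition bump :: "real \<Rightarrow> 'e::euclidean_space \<Rightarrow> 'e \<Rightarrow> 'e \<Rightarrow> real" where
  "bump c a d x = (\<Prod>b\<in>Basis. flat c 1 (x \<bullet> b - a \<bullet> b) * flat c 1 (d \<bullet> b - x \<bullet> b))"

lemma bump_test_function:
  assumes U: "open U" and c: "c > 0" and box: "cbox a d \<subseteq> U"
  shows "bump c a d \<in> test_functions U"
proof (rule test_functionsI[OF _ compact_cbox box])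
  fix k
  have 1: "C_on k U (\<lambda>x. flat c 1 (x \<bullet> b - a \<bullet> b))" for b
    using C_on_flat[OF c U, of k 1 b "- (a \<bullet> b)"] by simp
  have 2: "C_on k U (\<lambda>x. flat c 1 (d \<bullet> b - x \<bullet> b))" for b
    using C_on_flat[OF c U, of k 1 "- b" "d \<bullet> b"] by simp
  have "C_on k U (\<lambda>x. bump c a d x)"
    unfolding bump_def by (intro C_on_prod C_on_mult U 1 2) simp
  then show "C_on k U (bump c a d)" by simp
next
  fix x assume "x \<notin> cbox a d"
  then obtain b where "b \<in> Basis" "\<not> (a \<bullet> b \<le> x \<bullet> b \<and> x \<bullet> b \<le> d \<bullet> b)"
    by (auto simp: mem_box)
  then show "bump c a d x = 0"
    unfolding bump_def by (intro prod_zero bexI[of _ b]) (auto simp: flat_def)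
qed

lemma abs_bump_le_indicator: "c > 0 \<Longrightarrow> \<bar>bump c a d x\<bar> \<le> indicator (box a d) x"
proof (cases "x \<in> box a d")
  case True
  assume "c > 0"
  then have "\<bar>bump c a d x\<bar> \<le> (\<Prod>b\<in>(Basis::'a set). 1)"
    unfolding bump_def abs_prod by (intro prod_mono) (auto simp: flat_def abs_mult intro!: mult_le_one)
  with True show ?thesis by simp
next
  case False
  then obtain b where "b \<in> Basis" "\<not> (a \<bullet> b < x \<bullet> b \<and> x \<bullet> b < d \<bullet> b)"
    by (auto simp: mem_box)
  then have "bump c a d x = 0"
    unfolding bump_def by (intro prod_zero bexI[of _ b]) (auto simp: flat_def)
  then show ?thesis by simp
qed

lemma bump_tendsto_indicator:
  "(\<lambda>n. bump (inverse (real (Suc n))) a d x) \<longlonglongrightarrow> indicator (box a d) x"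
proof (cases "x \<in> box a d")
  case True
  have lim: "(\<lambda>n. flat (inverse (real (Suc n))) 1 t) \<longlonglongrightarrow> 1" if "t > 0" for t
  proof -
    have "(\<lambda>n. exp (- inverse (real (Suc n)) / t)) \<longlonglongrightarrow> exp (- 0 / t)"
      using that by (intro tendsto_intros LIMSEQ_inverse_real_of_nat) auto
    with that show ?thesis by (simp add: flat_def)
  qed
  have "(\<lambda>n. bump (inverse (real (Suc n))) a d x) \<longlonglongrightarrow> (\<Prod>b\<in>(Basis::'a set). 1 * 1)"
    unfolding bump_def using True by (intro tendsto_prod tendsto_mult lim) (auto simp: mem_box)
  with True show ?thesis by simp
next
  case False
  have "bump (inverse (real (Suc n))) a d x = 0" for n
    using abs_bump_le_indicator[of "inverse (real (Suc n))" a d x] False by simp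
  with False show ?thesis by simp
qed

section \<open>Uniqueness of weak gradients\<close>

lemma borel_measurable_lebesgue: "f \<in> borel_measurable borel \<Longrightarrow> f \<in> borel_measurable lebesgue"
  by (rule measurable_completion) simp

text \<open>
  Open boxes form an intersection-stable generator of the Borel sets, so that the integral of \<open>f\<close> over
  every Borel set vanishes.
\<close>

lemma AE_zero_if_box_integrals_zero:
  fixes f :: "'e::euclidean_space \<Rightarrow> real"
  assumes f: "integrable lborel f" and total: "integral\<^sup>L lborel f = 0"
    and box: "\<And>a b. (LINT x:box a b|lborel. f x) = 0"
  shows "AE x in lborel. f x = 0"
proof (rule sigma_finite_measure.density_zero[OF lborel.sigma_finite_measure_axioms f])
  fix A :: "'e set" assume "A \<in> sets lborel"
  then have A: "A \<in> sigma_sets UNIV (range (\<lambda>(a, b). box a b))"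
    unfolding sets_lborel borel_eq_box by simp
  have meas: "B \<in> sets lborel" if "B \<in> sigma_sets UNIV (range (\<lambda>(a, b). box a b :: 'e set))" for B
    using that unfolding sets_lborel borel_eq_box by simp
  have int: "set_integrable lborel B f" if "B \<in> sets lborel" for B
    using integrable_mult_indicator[OF that f] by (simp only: set_integrable_def)
  have "Int_stable (range (\<lambda>(a, b). box a b :: 'e set))"
  proof (rule Int_stableI)
    fix A B :: "'e set" assume "A \<in> range (\<lambda>(a, b). box a b :: 'e set)" "B \<in> range (\<lambda>(a, b). box a b)"
    then obtain a b c d where AB: "A = box a b" "B = box c d" by auto
    obtain p q where "A \<inter> B = box p q" unfolding AB box_Int_box by blast
    then show "A \<inter> B \<in> range (\<lambda>(a, b). box a b)"
      by (intro range_eqI[of _ _ "(p, q)"]) simp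
  qed
  moreover have "range (\<lambda>(a, b). box a b :: 'e set) \<subseteq> Pow UNIV" by simp
  ultimately show "(LINT x:A|lborel. f x) = 0"
    using A
  proof (induction rule: sigma_sets_induct_disjoint)
    case (basic A)
    then obtain a b where "A = box a b" by auto
    then show ?case using box[of a b] by simp
  next
    case empty
    show ?case by (simp add: set_lebesgue_integral_def)
  next
    case (compl A)
    have "indicator (UNIV - A) x * f x = f x - indicator A x * f x" for x
      by (simp add: indicator_def)
    then have "(LINT x:UNIV - A|lborel. f x) = (LINT x|lborel. f x - indicator A x * f x)"
      by (simp only: set_lebesgue_integral_def real_scaleR_def)
    also have "\<dots> = integral\<^sup>L lborel f - (LINT x:A|lborel. f x)"
      using f int[OF meas[OF compl(1)]] unfolding set_lebesgue_integral_def set_integrable_def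
      by (subst Bochner_Integration.integral_diff) simp_all
    also have "\<dots> = 0" using compl(2) total by simp
    finally show ?case .
  next
    case (union A)
    have A: "A i \<in> sets lborel" for i by (rule meas, rule subsetD[OF union(2)], rule rangeI)
    have "(LINT x:(\<Union>i. A i)|lborel. f x) = (\<Sum>i. (LINT x:(A i)|lborel. f x))"
    proof (rule lebesgue_integral_countable_add)
      show "A i \<inter> A j = {}" if "i \<noteq> j" for i j
        using union(1) that by (simp add: disjoint_family_on_def)
      show "set_integrable lborel (\<Union>i. A i) f" using A by (intro int sets.countable_UN image_subsetI)
    qed (rule A)
    also have "\<dots> = 0" using union(3) by simp
    finally show ?case .
  qed
qed

lemma locally_integrable_box:
  fixes h :: "'e::euclidean_space \<Rightarrow> real"
  assumes h: "locally_integrable U h" and ad: "cbox a d \<subseteq> U"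
  shows "integrable lebesgue (\<lambda>x. indicator (cbox a d) x * h x)"
  using assms by (simp add: locally_integrable_def set_integrable_def compact_cbox)

text \<open>The bump functions of a box converge, boundedly, to its indicator function.\<close>

lemma box_integral_zero_if_orthogonal_to_test_functions:
  fixes h :: "'e::euclidean_space \<Rightarrow> real"
  assumes U: "open U" and h: "locally_integrable U h"
    and 0: "\<And>\<phi>. \<phi> \<in> test_functions U \<Longrightarrow> (LINT x|lebesgue_on U. h x * \<phi> x) = 0"
    and ad: "cbox a d \<subseteq> U"
  shows "(LINT x|lebesgue. indicator (box a d) x * h x) = 0"
proof -
  define c :: "nat \<Rightarrow> real" where "c n = inverse (real (Suc n))" for n
  have c: "c n > 0" for n by (simp add: c_def)
  let ?h = "\<lambda>x. indicator (cbox a d) x * h x"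
  have int: "integrable lebesgue ?h" using locally_integrable_box[OF h ad] .
  have zero: "bump (c n) a d x = 0" if "x \<notin> box a d" for n x
    using abs_bump_le_indicator[OF c, of n a d x] that by simp
  have meas: "(\<lambda>x. bump (c n) a d x) \<in> borel_measurable lebesgue" for n
  proof -
    have "bump (c n) a d \<in> test_functions UNIV" by (rule bump_test_function) (auto intro: c)
    then have "C_on 0 UNIV (bump (c n) a d)" unfolding test_functions_def smooth_on_def by blast
    then have "continuous_on UNIV (bump (c n) a d)" by simp
    then show ?thesis
      by (intro borel_measurable_lebesgue borel_measurable_continuous_onI)
  qed
  have "(\<lambda>n. LINT x|lebesgue. bump (c n) a d x * ?h x) \<longlonglongrightarrow>
      (LINT x|lebesgue. indicator (box a d) x * h x)"
  proof (rule integral_dominated_convergence[where w = "\<lambda>x. \<bar>?h x\<bar>"])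
    show "(\<lambda>x. indicator (box a d) x * h x) \<in> borel_measurable lebesgue"
    proof -
      have "(\<lambda>x. indicator (box a d) x * ?h x) \<in> borel_measurable lebesgue"
        by (rule borel_measurable_times[OF borel_measurable_indicator borel_measurable_integrable[OF int]])
          simp
      moreover have "indicator (box a d) x * ?h x = indicator (box a d) x * h x" for x
        using box_subset_cbox[of a d] by (auto simp: indicator_def)
      ultimately show ?thesis by simp
    qed
    show "(\<lambda>x. bump (c n) a d x * ?h x) \<in> borel_measurable lebesgue" for n
      by (rule borel_measurable_times[OF meas borel_measurable_integrable[OF int]])
    show "AE x in lebesgue. (\<lambda>n. bump (c n) a d x * ?h x) \<longlonglongrightarrow> indicator (box a d) x * h x"
    proof (rule AE_I2)
      fix x
      have "(\<lambda>n. bump (c n) a d x * ?h x) \<longlonglongrightarrow> indicator (box a d) x * ?h x"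
        unfolding c_def by (intro tendsto_mult bump_tendsto_indicator tendsto_const)
      moreover have "indicator (box a d) x * ?h x = indicator (box a d) x * h x"
        using box_subset_cbox[of a d] by (auto simp: indicator_def)
      ultimately show "(\<lambda>n. bump (c n) a d x * ?h x) \<longlonglongrightarrow> indicator (box a d) x * h x" by simp
    qed
    show "AE x in lebesgue. norm (bump (c n) a d x * ?h x) \<le> \<bar>?h x\<bar>" for n
    proof (rule AE_I2)
      fix x
      have "\<bar>bump (c n) a d x\<bar> \<le> 1"
        using abs_bump_le_indicator[OF c, of n a d x] by (rule order_trans) (simp add: indicator_def)
      then show "norm (bump (c n) a d x * ?h x) \<le> \<bar>?h x\<bar>"
        by (simp add: abs_mult mult_left_le_one_le del: abs_mult_pos)
    qed
  qed (use int in auto)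
  moreover have "(LINT x|lebesgue. bump (c n) a d x * ?h x) = 0" for n
  proof -
    have "bump (c n) a d x * ?h x = indicator U x *\<^sub>R (h x * bump (c n) a d x)" for x
      using ad box_subset_cbox[of a d] zero[of x n] by (auto simp: indicator_def)
    then have "(LINT x|lebesgue. bump (c n) a d x * ?h x) =
        (LINT x|lebesgue. indicator U x *\<^sub>R (h x * bump (c n) a d x))"
      by (simp only:)
    also have "\<dots> = (LINT x|lebesgue_on U. h x * bump (c n) a d x)"
      by (rule integral_restrict_space[symmetric]) (use U in auto)
    also have "\<dots> = 0" by (intro 0 bump_test_function U c ad)
    finally show ?thesis .
  qed
  ultimately show ?thesis by (simp add: LIMSEQ_const_iff)
qed

text \<open>
  The fundamental lemma of the calculus of variations: on each closed box in \<open>U\<close> the integrals of \<open>h\<close>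
  over all smaller boxes vanish, and countably many closed boxes cover \<open>U\<close>.
\<close>

lemma AE_zero_if_orthogonal_to_test_functions:
  fixes h :: "'e::euclidean_space \<Rightarrow> real"
  assumes U: "open U" and h: "locally_integrable U h"
    and 0: "\<And>\<phi>. \<phi> \<in> test_functions U \<Longrightarrow> (LINT x|lebesgue_on U. h x * \<phi> x) = 0"
  shows "AE x in lebesgue_on U. h x = 0"
proof -
  have box_zero: "(LINT x|lebesgue. indicator (box a d) x * h x) = 0" if "cbox a d \<subseteq> U" for a d
    by (rule box_integral_zero_if_orthogonal_to_test_functions[OF U h 0 that])
  have *: "AE x in lebesgue. x \<in> cbox c d \<longrightarrow> h x = 0" if cd: "cbox c d \<subseteq> U" for c d
  proof -
    \<comment> \<open>Restricting to the open box makes its intersection with any open box an open box again;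
      the boundary that is lost is a null set.\<close>
    define F where "F x = indicator (box c d) x * h x" for x
    have "integrable lebesgue (\<lambda>x. indicator (box c d) x *\<^sub>R (indicator (cbox c d) x * h x))"
      by (rule integrable_mult_indicator[OF _ locally_integrable_box[OF h cd]]) auto
    moreover have "indicator (box c d) x *\<^sub>R (indicator (cbox c d) x * h x) = F x" for x
      using box_subset_cbox[of c d] by (auto simp: F_def indicator_def)
    ultimately have F: "integrable lebesgue F" by simp
    obtain F' where F': "F' \<in> borel_measurable lborel" "AE x in lborel. F x = F' x"
      using completion_ex_borel_measurable_real[OF borel_measurable_integrable[OF F]] by blast
    have ae: "AE x in lebesgue. F x = F' x" using F'(2) by (rule AE_completion)
    have meas: "F' \<in> borel_measurable lebesgue" using F'(1) by (rule measurable_completion)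
    have "integrable lebesgue F'"
      using F meas ae by (rule Bochner_Integration.integrable_cong_AE_imp)
    then have int: "integrable lborel F'" using F'(1) by (simp add: integrable_completion)
    have box': "(LINT x|lebesgue. indicator (box a b) x * F x) = 0" for a b
    proof -
      obtain p q where pq: "box a b \<inter> box c d = box p q" unfolding box_Int_box by blast
      have eq: "indicator (box a b) x * F x = indicator (box p q) x * h x" for x
        by (simp add: F_def flip: pq) (simp add: indicator_def)
      show ?thesis
      proof (cases "box p q = {}")
        case True
        then show ?thesis unfolding eq by simp
      next
        case False
        then have "cbox p q \<subseteq> cbox c d"
          using pq by (metis Int_lower2 closure_box closure_mono closure_cbox order_trans box_subset_cbox
              closure_minimal closed_cbox)
        then show ?thesis unfolding eq using cd by (intro box_zero) auto
      qed
    qed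
    have "AE x in lborel. F' x = 0"
    proof (rule AE_zero_if_box_integrals_zero[OF int])
      have "integral\<^sup>L lborel F' = integral\<^sup>L lebesgue F"
        using ae F'(1) F meas
        by (subst integral_completion[symmetric]) (auto intro!: integral_cong_AE)
      also have "\<dots> = 0" using box_zero[OF cd] unfolding F_def[abs_def] .
      finally show "integral\<^sup>L lborel F' = 0" .
      fix a b
      have "(LINT x:box a b|lborel. F' x) = (LINT x|lebesgue. indicator (box a b) x * F' x)"
        using F'(1) by (simp add: set_lebesgue_integral_def integral_completion)
      also have "\<dots> = (LINT x|lebesgue. indicator (box a b) x * F x)"
        using ae
        by (intro integral_cong_AE borel_measurable_times borel_measurable_indicator
            borel_measurable_integrable[OF F] meas) auto
      also have "\<dots> = 0" by (rule box')
      finally show "(LINT x:box a b|lborel. F' x) = 0" .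
    qed
    then have "AE x in lebesgue. F' x = 0" by (rule AE_completion)
    moreover have "AE x in lebesgue. x \<notin> cbox c d - box c d"
      using negligible_frontier_interval[of c d] by (intro AE_not_in) (simp add: negligible_iff_null_sets)
    ultimately show ?thesis
      using ae by eventually_elim (auto simp: F_def indicator_def split: if_splits)
  qed
  obtain \<D> where \<D>: "countable \<D>" "\<D> \<subseteq> Pow U" "\<And>X. X \<in> \<D> \<Longrightarrow> \<exists>a b. X = cbox a b" "\<Union>\<D> = U"
    using open_countable_Union_open_cbox[OF U] by blast
  have "AE x in lebesgue. \<forall>X\<in>\<D>. x \<in> X \<longrightarrow> h x = 0"
  proof (rule AE_ball_countable'[OF _ \<D>(1)])
    fix X assume "X \<in> \<D>"
    with \<D>(2,3) * show "AE x in lebesgue. x \<in> X \<longrightarrow> h x = 0" by blast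
  qed
  then have "AE x in lebesgue. x \<in> U \<longrightarrow> h x = 0"
    using \<D>(4) by (auto elim!: eventually_mono)
  with U show ?thesis by (subst AE_restrict_space_iff) auto
qed

text \<open>
  Test functions and their partial derivatives are bounded with compact support, so that all integrals
  in the definition of the weak gradient exist and may be added.
\<close>

lemma integrable_mult_compact_support:
  fixes f \<psi> :: "'e::euclidean_space \<Rightarrow> real"
  assumes U: "open U" and f: "locally_integrable U f" and K: "compact K" "K \<subseteq> U"
    and \<psi>: "continuous_on U \<psi>" "\<And>x. x \<notin> K \<Longrightarrow> \<psi> x = 0"
  shows "integrable (lebesgue_on U) (\<lambda>x. f x * \<psi> x)"
proof -
  let ?f = "\<lambda>x. indicator K x *\<^sub>R f x" and ?\<psi> = "\<lambda>x. indicator K x *\<^sub>R \<psi> x"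
  have f': "integrable lebesgue ?f"
    using f K by (simp add: locally_integrable_def set_integrable_def)
  have cont: "continuous_on K \<psi>" using \<psi>(1) K(2) by (rule continuous_on_subset)
  then have "bounded (\<psi> ` K)" using K(1) by (intro compact_imp_bounded compact_continuous_image)
  then obtain B where B: "\<And>x. x \<in> K \<Longrightarrow> \<bar>\<psi> x\<bar> \<le> B" by (auto simp: bounded_iff)
  have meas: "?\<psi> \<in> borel_measurable lebesgue"
    using K(1) cont
    by (intro borel_measurable_lebesgue borel_measurable_continuous_on_indicator) (auto intro: borel_compact)
  have "integrable lebesgue (\<lambda>x. ?f x * ?\<psi> x)"
  proof (rule Bochner_Integration.integrable_bound)
    show "integrable lebesgue (\<lambda>x. B * ?f x)" using f' by (rule integrable_mult_right)
    show "(\<lambda>x. ?f x * ?\<psi> x) \<in> borel_measurable lebesgue"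
      using borel_measurable_times[OF borel_measurable_integrable[OF f'] meas] .
    show "AE x in lebesgue. norm (?f x * ?\<psi> x) \<le> norm (B * ?f x)"
    proof (rule AE_I2)
      fix x
      show "norm (?f x * ?\<psi> x) \<le> norm (B * ?f x)"
      proof (cases "x \<in> K")
        case True
        have "\<bar>f x\<bar> * \<bar>\<psi> x\<bar> \<le> \<bar>f x\<bar> * \<bar>B\<bar>" using B[OF True] by (intro mult_left_mono) auto
        with True show ?thesis by (simp add: abs_mult mult.commute)
      qed simp
    qed
  qed
  moreover have "?f x * ?\<psi> x = indicator U x *\<^sub>R (f x * \<psi> x)" for x
    using K(2) \<psi>(2)[of x] by (auto simp: indicator_def)
  ultimately have "integrable lebesgue (\<lambda>x. indicator U x *\<^sub>R (f x * \<psi> x))" by (simp only:)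
  moreover have "U \<inter> space lebesgue \<in> sets lebesgue" using U by auto
  ultimately show ?thesis by (simp only: integrable_restrict_space)
qed

lemma integrable_mult_test_function:
  fixes f :: "'e::euclidean_space \<Rightarrow> real"
  assumes U: "open U" and f: "locally_integrable U f" and \<phi>: "\<phi> \<in> test_functions U"
  shows "integrable (lebesgue_on U) (\<lambda>x. f x * \<phi> x)"
proof (rule integrable_mult_compact_support[OF U f, of "supp \<phi>"])
  show "compact (supp \<phi>)" "supp \<phi> \<subseteq> U" using \<phi> by (auto simp: test_functions_def)
  have "C_on 0 U \<phi>" using \<phi> unfolding test_functions_def smooth_on_def by blast
  then show "continuous_on U \<phi>" by simp
qed (rule zero_outside_supp)

lemma integrable_mult_deriv_test_function:
  fixes f :: "'e::euclidean_space \<Rightarrow> real"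
  assumes U: "open U" and f: "locally_integrable U f" and \<phi>: "\<phi> \<in> test_functions U" and b: "b \<in> Basis"
  shows "integrable (lebesgue_on U) (\<lambda>x. f x * frechet_derivative \<phi> (at x) b)"
proof (rule integrable_mult_compact_support[OF U f, of "supp \<phi>"])
  show "compact (supp \<phi>)" "supp \<phi> \<subseteq> U" using \<phi> by (auto simp: test_functions_def)
  have "C_on (Suc 0) U \<phi>" using \<phi> unfolding test_functions_def smooth_on_def by blast
  then show "continuous_on U (\<lambda>x. frechet_derivative \<phi> (at x) b)" using b by simp
  show "frechet_derivative \<phi> (at x) b = 0" if "x \<notin> supp \<phi>" for x
    using frechet_derivative_zero_outside[OF closed_supp zero_outside_supp[of _ \<phi>] that] by simp
qed

lemma locally_integrable_add:
  "locally_integrable U f \<Longrightarrow> locally_integrable U g \<Longrightarrow> locally_integrable U (\<lambda>x. f x + g x)"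
  by (simp add: locally_integrable_def set_integral_add)

lemma locally_integrable_scaleR:
  "locally_integrable U f \<Longrightarrow> locally_integrable U (\<lambda>x. c *\<^sub>R f x)"
  by (simp add: locally_integrable_def)

lemma locally_integrable_inner:
  assumes "locally_integrable U f"
  shows "locally_integrable U (\<lambda>x. f x \<bullet> b)"
  unfolding locally_integrable_def
proof (intro allI impI)
  fix K assume "compact K \<and> K \<subseteq> U"
  then have "integrable lebesgue (\<lambda>x. indicator K x *\<^sub>R f x)"
    using assms by (simp add: locally_integrable_def set_integrable_def)
  then have "integrable lebesgue (\<lambda>x. (indicator K x *\<^sub>R f x) \<bullet> b)"
    by (intro integrable_inner_left)
  then show "set_integrable lebesgue K (\<lambda>x. f x \<bullet> b)"
    by (simp add: set_integrable_def)
qed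

lemma has_weak_gradient_unique:
  assumes U: "open U" and g1: "has_weak_gradient U u g1" and g2: "has_weak_gradient U u g2"
  shows "AE x in lebesgue_on U. g1 x = g2 x"
proof -
  have li: "locally_integrable U (\<lambda>x. g1 x \<bullet> b)" "locally_integrable U (\<lambda>x. g2 x \<bullet> b)" for b
    using g1 g2 by (auto simp: has_weak_gradient_def intro: locally_integrable_inner)
  have "AE x in lebesgue_on U. g1 x \<bullet> b + (-1) *\<^sub>R (g2 x \<bullet> b) = 0" if b: "b \<in> Basis" for b
  proof (rule AE_zero_if_orthogonal_to_test_functions[OF U])
    show "locally_integrable U (\<lambda>x. g1 x \<bullet> b + (-1) *\<^sub>R (g2 x \<bullet> b))"
      by (intro locally_integrable_add locally_integrable_scaleR li)
    fix \<phi> assume \<phi>: "\<phi> \<in> test_functions U"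
    have "(LINT x|lebesgue_on U. (g1 x \<bullet> b) * \<phi> x) = (LINT x|lebesgue_on U. (g2 x \<bullet> b) * \<phi> x)"
      using g1 g2 \<phi> b by (auto simp: has_weak_gradient_def)
    then show "(LINT x|lebesgue_on U. (g1 x \<bullet> b + (-1) *\<^sub>R (g2 x \<bullet> b)) * \<phi> x) = 0"
      using integrable_mult_test_function[OF U li(1) \<phi>] integrable_mult_test_function[OF U li(2) \<phi>]
      by (simp add: left_diff_distrib Bochner_Integration.integral_diff)
  qed
  then have "AE x in lebesgue_on U. \<forall>b\<in>Basis. g1 x \<bullet> b + (-1) *\<^sub>R (g2 x \<bullet> b) = 0"
    by (intro AE_ball_countable') (auto intro: countable_finite)
  then show ?thesis by eventually_elim (rule euclidean_eqI, simp)
qed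

section \<open>The weighted gradient form\<close>

lemma has_weak_gradient_add:
  assumes U: "open U" and g1: "has_weak_gradient U u1 g1" and g2: "has_weak_gradient U u2 g2"
  shows "has_weak_gradient U (\<lambda>x. u1 x + u2 x) (\<lambda>x. g1 x + g2 x)"
proof -
  have li: "locally_integrable U u1" "locally_integrable U u2"
      "locally_integrable U g1" "locally_integrable U g2"
    using g1 g2 by (auto simp: has_weak_gradient_def)
  have "(LINT x|lebesgue_on U. (u1 x + u2 x) * frechet_derivative \<phi> (at x) b) =
      - (LINT x|lebesgue_on U. ((g1 x + g2 x) \<bullet> b) * \<phi> x)"
    if \<phi>: "\<phi> \<in> test_functions U" and b: "b \<in> Basis" for \<phi> b
  proof -
    note I = integrable_mult_deriv_test_function[OF U li(1) \<phi> b]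
      integrable_mult_deriv_test_function[OF U li(2) \<phi> b]
      integrable_mult_test_function[OF U locally_integrable_inner[OF li(3)] \<phi>]
      integrable_mult_test_function[OF U locally_integrable_inner[OF li(4)] \<phi>]
    have "(LINT x|lebesgue_on U. u1 x * frechet_derivative \<phi> (at x) b) =
        - (LINT x|lebesgue_on U. (g1 x \<bullet> b) * \<phi> x)"
      "(LINT x|lebesgue_on U. u2 x * frechet_derivative \<phi> (at x) b) =
        - (LINT x|lebesgue_on U. (g2 x \<bullet> b) * \<phi> x)"
      using g1 g2 \<phi> b by (auto simp: has_weak_gradient_def)
    then show ?thesis
      using I by (simp add: distrib_right inner_add_left)
  qed
  with li show ?thesis
    by (simp add: has_weak_gradient_def locally_integrable_add)
qed

lemma has_weak_gradient_scale:
  assumes g: "has_weak_gradient U u g"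
  shows "has_weak_gradient U (\<lambda>x. c * u x) (\<lambda>x. c *\<^sub>R g x)"
  using assms locally_integrable_scaleR[of U u c] locally_integrable_scaleR[of U g c]
  by (simp add: has_weak_gradient_def mult.assoc)

lemma has_weak_gradient_zero: "has_weak_gradient U (\<lambda>x. 0) (\<lambda>x. 0)"
  by (simp add: has_weak_gradient_def locally_integrable_def set_integrable_def)

lemma integrable_weighted_inner:
  fixes f g :: "'e::euclidean_space \<Rightarrow> 'b::euclidean_space"
  assumes w: "is_weight U w" and f: "f \<in> L2_weighted U w" and g: "g \<in> L2_weighted U w"
  shows "integrable (lebesgue_on U) (\<lambda>x. w x * (f x \<bullet> g x))"
proof (rule Bochner_Integration.integrable_bound)
  let ?M = "lebesgue_on U"
  show "integrable ?M (\<lambda>x. (norm (f x))\<^sup>2 * w x + (norm (g x))\<^sup>2 * w x)"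
    using f g by (simp add: L2_weighted_def)
  show "(\<lambda>x. w x * (f x \<bullet> g x)) \<in> borel_measurable ?M"
    using w f g by (intro borel_measurable_times borel_measurable_inner)
      (auto simp: is_weight_def L2_weighted_def)
  have "AE x in ?M. 0 < w x" using w by (simp add: is_weight_def)
  then show "AE x in ?M. norm (w x * (f x \<bullet> g x)) \<le>
      norm ((norm (f x))\<^sup>2 * w x + (norm (g x))\<^sup>2 * w x)"
  proof eventually_elim
    case (elim x)
    have "\<bar>f x \<bullet> g x\<bar> \<le> norm (f x) * norm (g x)" by (rule Cauchy_Schwarz_ineq2)
    also have "\<dots> \<le> (norm (f x))\<^sup>2 + (norm (g x))\<^sup>2"
      using sum_squares_bound[of "norm (f x)" "norm (g x)"]
        mult_nonneg_nonneg[OF norm_ge_zero[of "f x"] norm_ge_zero[of "g x"]] by linarith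
    finally have "w x * \<bar>f x \<bullet> g x\<bar> \<le> w x * ((norm (f x))\<^sup>2 + (norm (g x))\<^sup>2)"
      using elim by (intro mult_left_mono) auto
    also have "\<dots> = norm ((norm (f x))\<^sup>2 * w x + (norm (g x))\<^sup>2 * w x)"
      using elim by (simp add: algebra_simps)
    finally show ?case using elim by (simp add: abs_mult)
  qed
qed

lemma L2_weighted_add:
  fixes f g :: "'e::euclidean_space \<Rightarrow> 'b::euclidean_space"
  assumes w: "is_weight U w" and f: "f \<in> L2_weighted U w" and g: "g \<in> L2_weighted U w"
  shows "(\<lambda>x. f x + g x) \<in> L2_weighted U w"
proof -
  have "integrable (lebesgue_on U)
      (\<lambda>x. (norm (f x))\<^sup>2 * w x + (norm (g x))\<^sup>2 * w x + 2 * (w x * (f x \<bullet> g x)))"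
    using f g integrable_weighted_inner[OF w f g] by (simp add: L2_weighted_def)
  moreover have "(norm (f x))\<^sup>2 * w x + (norm (g x))\<^sup>2 * w x + 2 * (w x * (f x \<bullet> g x)) =
      (norm (f x + g x))\<^sup>2 * w x" for x
    by (simp add: power2_norm_eq_inner inner_add_left inner_add_right inner_commute algebra_simps)
  ultimately show ?thesis using f g by (simp add: L2_weighted_def borel_measurable_add)
qed

lemma L2_weighted_scaleR:
  "f \<in> L2_weighted U w \<Longrightarrow> (\<lambda>x. c *\<^sub>R f x) \<in> L2_weighted U w"
  by (simp add: L2_weighted_def power_mult_distrib mult.assoc borel_measurable_scaleR)

lemma L2_weighted_cong_AE:
  fixes f g :: "'e::euclidean_space \<Rightarrow> 'b::euclidean_space"
  assumes U: "open U" and w: "is_weight U w"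
    and f: "f \<in> L2_weighted U w" and ae: "AE x in lebesgue_on U. f x = g x"
  shows "g \<in> L2_weighted U w"
proof -
  have sets: "U \<inter> space lebesgue \<in> sets lebesgue" using U by auto
  have "(\<lambda>x. indicator U x *\<^sub>R f x) \<in> borel_measurable lebesgue"
    using f borel_measurable_restrict_space_iff[OF sets, of f] by (simp add: L2_weighted_def)
  moreover have "AE x in lebesgue. indicator U x *\<^sub>R f x = indicator U x *\<^sub>R g x"
    using ae unfolding AE_restrict_space_iff[OF sets] by eventually_elim (auto simp: indicator_def)
  ultimately have "(\<lambda>x. indicator U x *\<^sub>R g x) \<in> borel_measurable lebesgue"
    by (rule borel_measurable_AE)
  then have g: "g \<in> borel_measurable (lebesgue_on U)"
    using borel_measurable_restrict_space_iff[OF sets, of g] by simp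
  moreover have "integrable (lebesgue_on U) (\<lambda>x. (norm (g x))\<^sup>2 * w x)"
  proof (rule Bochner_Integration.integrable_cong_AE_imp)
    show "integrable (lebesgue_on U) (\<lambda>x. (norm (f x))\<^sup>2 * w x)"
      using f by (simp add: L2_weighted_def)
    show "(\<lambda>x. (norm (g x))\<^sup>2 * w x) \<in> borel_measurable (lebesgue_on U)"
      using g w by (auto simp: is_weight_def)
    show "AE x in lebesgue_on U. (norm (f x))\<^sup>2 * w x = (norm (g x))\<^sup>2 * w x"
      using ae by eventually_elim simp
  qed
  ultimately show ?thesis by (simp add: L2_weighted_def)
qed

text \<open>
  The weak gradient of \<open>u\<close> is an arbitrary representative; by uniqueness it may be replaced by any
  convenient one, which is what makes it linear up to null sets and square-integrable.
\<close>

lemma weak_gradient_eqI: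
  assumes U: "open U" and g: "has_weak_gradient U u g"
  shows "AE x in lebesgue_on U. weak_gradient U u x = g x"
proof -
  have "has_weak_gradient U u (weak_gradient U u)"
    unfolding weak_gradient_def using g by (rule someI[where P = "has_weak_gradient U u"])
  then show ?thesis using g by (rule has_weak_gradient_unique[OF U])
qed

lemma L12_weightedD:
  assumes U: "open U" and w: "is_weight U w" and u: "u \<in> L12_weighted U w"
  shows "has_weak_gradient U u (weak_gradient U u)" "weak_gradient U u \<in> L2_weighted U w"
proof -
  obtain g where g: "has_weak_gradient U u g" "g \<in> L2_weighted U w"
    using u by (auto simp: L12_weighted_def)
  show "has_weak_gradient U u (weak_gradient U u)"
    unfolding weak_gradient_def using g(1) by (rule someI[where P = "has_weak_gradient U u"])
  have "AE x in lebesgue_on U. g x = weak_gradient U u x"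
    using weak_gradient_eqI[OF U g(1)] by eventually_elim simp
  with g(2) show "weak_gradient U u \<in> L2_weighted U w"
    by (rule L2_weighted_cong_AE[OF U w])
qed

lemma L12_weightedI:
  "u \<in> borel_measurable (lebesgue_on U) \<Longrightarrow> has_weak_gradient U u g \<Longrightarrow> g \<in> L2_weighted U w \<Longrightarrow>
    u \<in> L12_weighted U w"
  unfolding L12_weighted_def by blast

lemma L12_weighted_measurable: "u \<in> L12_weighted U w \<Longrightarrow> u \<in> borel_measurable (lebesgue_on U)"
  by (simp add: L12_weighted_def)

lemma L12_weighted_add:
  assumes U: "open U" and w: "is_weight U w" and u: "u \<in> L12_weighted U w" and v: "v \<in> L12_weighted U w"
  shows "(\<lambda>x. u x + v x) \<in> L12_weighted U w"
  using L12_weighted_measurable[OF u] L12_weighted_measurable[OF v]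
  by (intro L12_weightedI[OF _ has_weak_gradient_add[OF U L12_weightedD(1)[OF U w u] L12_weightedD(1)[OF U w v]]
      L2_weighted_add[OF w L12_weightedD(2)[OF U w u] L12_weightedD(2)[OF U w v]]])
    (rule borel_measurable_add)

lemma L12_weighted_scale:
  assumes U: "open U" and w: "is_weight U w" and u: "u \<in> L12_weighted U w"
  shows "(\<lambda>x. c * u x) \<in> L12_weighted U w"
  using L12_weighted_measurable[OF u]
  by (intro L12_weightedI[OF _ has_weak_gradient_scale[OF L12_weightedD(1)[OF U w u]]
      L2_weighted_scaleR[OF L12_weightedD(2)[OF U w u]]]) simp

lemma zero_in_L12_weighted: "(\<lambda>x. 0) \<in> L12_weighted U w"
  by (rule L12_weightedI[OF _ has_weak_gradient_zero]) (simp_all add: L2_weighted_def)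

context
  fixes U :: "'e::euclidean_space set" and w :: "'e \<Rightarrow> real"
  assumes U: "open U" and w: "is_weight U w"
begin

lemma integrable_grad_inner:
  "u \<in> L12_weighted U w \<Longrightarrow> v \<in> L12_weighted U w \<Longrightarrow>
    integrable (lebesgue_on U) (\<lambda>x. w x * (weak_gradient U u x \<bullet> weak_gradient U v x))"
  by (intro integrable_weighted_inner[OF w] L12_weightedD(2)[OF U w])

lemma grad_inner_add_left:
  assumes u: "u \<in> L12_weighted U w" and v: "v \<in> L12_weighted U w" and x: "z \<in> L12_weighted U w"
  shows "grad_inner U w (\<lambda>x. u x + v x) z = grad_inner U w u z + grad_inner U w v z"
proof -
  let ?D = "weak_gradient U"
  note D = L12_weightedD(1)[OF U w u] L12_weightedD(1)[OF U w v]
  note uv = L12_weighted_add[OF U w u v]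
  have "AE x in lebesgue_on U. w x * (?D (\<lambda>x. u x + v x) x \<bullet> ?D z x) =
      w x * (?D u x \<bullet> ?D z x) + w x * (?D v x \<bullet> ?D z x)"
    using weak_gradient_eqI[OF U has_weak_gradient_add[OF U D]]
    by eventually_elim (simp add: inner_add_left distrib_left)
  then have "grad_inner U w (\<lambda>x. u x + v x) z =
      (LINT x|lebesgue_on U. w x * (?D u x \<bullet> ?D z x) + w x * (?D v x \<bullet> ?D z x))"
    unfolding grad_inner_def
    using integrable_grad_inner[OF uv x] integrable_grad_inner[OF u x] integrable_grad_inner[OF v x]
    by (intro integral_cong_AE borel_measurable_integrable Bochner_Integration.integrable_add)
  then show ?thesis
    unfolding grad_inner_def using integrable_grad_inner[OF u x] integrable_grad_inner[OF v x] by simp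
qed

lemma grad_inner_scale_left:
  assumes u: "u \<in> L12_weighted U w" and x: "z \<in> L12_weighted U w"
  shows "grad_inner U w (\<lambda>x. c * u x) z = c * grad_inner U w u z"
proof -
  let ?D = "weak_gradient U"
  note cu = L12_weighted_scale[OF U w u, of c]
  have "AE x in lebesgue_on U. w x * (?D (\<lambda>x. c * u x) x \<bullet> ?D z x) = c * (w x * (?D u x \<bullet> ?D z x))"
    using weak_gradient_eqI[OF U has_weak_gradient_scale[where c = c, OF L12_weightedD(1)[OF U w u]]]
    by eventually_elim simp
  then have "grad_inner U w (\<lambda>x. c * u x) z = (LINT x|lebesgue_on U. c * (w x * (?D u x \<bullet> ?D z x)))"
    unfolding grad_inner_def
    using integrable_grad_inner[OF cu x] integrable_grad_inner[OF u x]
    by (intro integral_cong_AE borel_measurable_integrable integrable_mult_right)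
  then show ?thesis
    unfolding grad_inner_def by simp
qed

lemma grad_inner_commute: "grad_inner U w u v = grad_inner U w v u"
  by (simp add: grad_inner_def inner_commute)

lemma grad_inner_nonneg: "0 \<le> grad_inner U w u u"
proof -
  have "AE x in lebesgue_on U. 0 < w x" using w by (simp add: is_weight_def)
  then show ?thesis
    unfolding grad_inner_def by (intro integral_nonneg_AE) (auto elim!: eventually_mono)
qed

end

section \<open>The spaces on the cylinder\<close>

lemma open_cyl: "open \<Omega> \<Longrightarrow> open (cyl \<Omega>)"
  by (simp add: cyl_def open_Times)

text \<open>
  The Lebesgue measure on the cylinder is the completion of a product of Borel measures, whereas \<open>s\<close>
  and \<open>G\<close> are only Lebesgue measurable. They are therefore replaced by Borel representatives; the
  exceptional null sets lift along the first projection.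
\<close>

lemma AE_lborel_fst:
  fixes P :: "'a::euclidean_space \<Rightarrow> bool"
  assumes "AE x in lborel. P x"
  shows "AE p in (lborel :: ('a \<times> 'b::euclidean_space) measure). P (fst p)"
proof -
  obtain N where N: "N \<in> null_sets lborel" "{x. \<not> P x} \<subseteq> N"
    using assms by (auto simp: eventually_ae_filter)
  have "N \<times> (UNIV :: 'b set) \<in> null_sets (lborel \<Otimes>\<^sub>M lborel)"
    using N(1) by (auto simp: null_sets_def lborel.emeasure_pair_measure_Times)
  then have "N \<times> (UNIV :: 'b set) \<in> null_sets lborel" by (simp add: lborel_prod)
  then show ?thesis
    by (rule AE_I') (use N(2) in auto)
qed

lemma is_weight_cyl_weight:
  fixes \<Omega> :: "(real^'n) set" and s G :: "real^'n \<Rightarrow> real"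
  assumes \<Omega>: "open \<Omega>" and s: "s \<in> borel_measurable (lebesgue_on \<Omega>)" and G: "is_weight \<Omega> G"
  shows "is_weight (cyl \<Omega>) (cyl_weight s G)"
proof -
  have sets: "\<Omega> \<inter> space lebesgue \<in> sets lebesgue" using \<Omega> by auto
  have sets': "cyl \<Omega> \<inter> space lebesgue \<in> sets lebesgue" using open_cyl[OF \<Omega>] by auto
  have "(\<lambda>x. indicator \<Omega> x *\<^sub>R s x) \<in> borel_measurable lebesgue"
    using s borel_measurable_restrict_space_iff[OF sets, of s] by simp
  then obtain s' where s': "s' \<in> borel_measurable lborel" "AE x in lborel. indicator \<Omega> x *\<^sub>R s x = s' x"
    using completion_ex_borel_measurable_real by blast
  have "G \<in> borel_measurable (lebesgue_on \<Omega>)" using G by (simp add: is_weight_def)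
  then have "(\<lambda>x. indicator \<Omega> x *\<^sub>R G x) \<in> borel_measurable lebesgue"
    using borel_measurable_restrict_space_iff[OF sets, of G] by simp
  then obtain G' where G': "G' \<in> borel_measurable lborel" "AE x in lborel. indicator \<Omega> x *\<^sub>R G x = G' x"
    using completion_ex_borel_measurable_real by blast
  have pos: "AE x in lborel. x \<in> \<Omega> \<longrightarrow> 0 < G x"
    using G unfolding is_weight_def AE_restrict_space_iff[OF sets] by (simp add: AE_completion_iff)
  define w' where "w' p = indicator (cyl \<Omega>) p * (G' (fst p) * snd p powr (1 - 2 * s' (fst p)))"
    for p :: "(real^'n) \<times> real"
  have [measurable]: "s' \<in> borel_measurable borel" "G' \<in> borel_measurable borel"
    using s'(1) G'(1) by simp_all
  have "(\<lambda>p. G' (fst p) * snd p powr (1 - 2 * s' (fst p))) \<in> borel_measurable (borel \<Otimes>\<^sub>M borel)"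
    by measurable
  then have meas: "(\<lambda>p. G' (fst p) * snd p powr (1 - 2 * s' (fst p))) \<in> borel_measurable borel"
    by (simp only: borel_prod)
  have "w' \<in> borel_measurable borel"
    unfolding w'_def[abs_def]
    by (rule borel_measurable_times[OF borel_measurable_indicator meas]) (use open_cyl[OF \<Omega>] in simp)
  then have w': "w' \<in> borel_measurable lebesgue" by (rule borel_measurable_lebesgue)
  have "AE p in lborel. w' p = indicator (cyl \<Omega>) p *\<^sub>R cyl_weight s G p"
    using AE_lborel_fst[OF s'(2)] AE_lborel_fst[OF G'(2)]
  proof eventually_elim
    case (elim p)
    then show ?case
      by (cases p) (auto simp: w'_def cyl_weight_def cyl_def indicator_def)
  qed
  then have "AE p in lebesgue. w' p = indicator (cyl \<Omega>) p *\<^sub>R cyl_weight s G p"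
    by (rule AE_completion)
  then have "(\<lambda>p. indicator (cyl \<Omega>) p *\<^sub>R cyl_weight s G p) \<in> borel_measurable lebesgue"
    by (rule borel_measurable_AE[OF w'])
  then have "cyl_weight s G \<in> borel_measurable (lebesgue_on (cyl \<Omega>))"
    using borel_measurable_restrict_space_iff[OF sets', of "cyl_weight s G"] by simp
  moreover have "AE p in lborel. p \<in> cyl \<Omega> \<longrightarrow> 0 < cyl_weight s G p"
    using AE_lborel_fst[OF pos]
  proof eventually_elim
    case (elim p)
    then show ?case by (cases p) (auto simp: cyl_weight_def cyl_def)
  qed
  then have "AE p in lebesgue_on (cyl \<Omega>). 0 < cyl_weight s G p"
    unfolding AE_restrict_space_iff[OF sets'] by (rule AE_completion)
  ultimately show ?thesis by (simp add: is_weight_def)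
qed

lemma test_functions_base_add:
  assumes \<Omega>: "open \<Omega>" and u: "u \<in> test_functions_base \<Omega>" and v: "v \<in> test_functions_base \<Omega>"
  shows "(\<lambda>x. u x + v x) \<in> test_functions_base \<Omega>"
proof -
  have "(\<lambda>x. u x + v x) \<in> smooth_on_closure (cyl \<Omega>)"
    using u v C_upto_bdry_add[OF open_cyl[OF \<Omega>]]
    by (simp add: test_functions_base_def smooth_on_closure_def continuous_on_add)
  moreover have "compact (supp (\<lambda>x. u x + v x))" "supp (\<lambda>x. u x + v x) \<subseteq> supp u \<union> supp v"
    using u v by - (rule compact_supp_subset[of "supp u \<union> supp v"];
        simp add: test_functions_base_def zero_outside_supp compact_Un)+
  ultimately show ?thesis using u v by (auto simp: test_functions_base_def)
qed

lemma test_functions_base_scale: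
  assumes \<Omega>: "open \<Omega>" and u: "u \<in> test_functions_base \<Omega>"
  shows "(\<lambda>x. c * u x) \<in> test_functions_base \<Omega>"
proof -
  have "(\<lambda>x. c * u x) \<in> smooth_on_closure (cyl \<Omega>)"
    using u C_upto_bdry_scale[OF open_cyl[OF \<Omega>]]
    by (simp add: test_functions_base_def smooth_on_closure_def continuous_on_mult_left)
  moreover have "compact (supp (\<lambda>x. c * u x))" "supp (\<lambda>x. c * u x) \<subseteq> supp u"
    using u by - (rule compact_supp_subset[of "supp u"];
        simp add: test_functions_base_def zero_outside_supp)+
  ultimately show ?thesis using u by (auto simp: test_functions_base_def)
qed

lemma test_functions_subset_base:
  assumes "open \<Omega>"
  shows "test_functions (cyl \<Omega>) \<subseteq> test_functions_base \<Omega>"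
proof
  fix u assume u: "u \<in> test_functions (cyl \<Omega>)"
  then have "u \<in> smooth_on_closure (cyl \<Omega>)"
    by (rule test_functions_smooth_on_closure[OF open_cyl[OF assms]])
  with u show "u \<in> test_functions_base \<Omega>"
    by (auto simp: test_functions_base_def test_functions_def cyl_base_def)
qed

text \<open>All that the abstract theory of completions and quotients requires of the cylinder.\<close>

lemma semi_ip_subspace_grad_space:
  assumes \<Omega>: "open \<Omega>" and w: "is_weight (cyl \<Omega>) w"
  shows "semi_ip_subspace (grad_space \<Omega> w (test_functions_base \<Omega>))
    (test_functions (cyl \<Omega>) \<inter> L12_weighted (cyl \<Omega>) w)"
proof
  note U = open_cyl[OF \<Omega>]
  let ?H = "grad_space \<Omega> w (test_functions_base \<Omega>)"
  let ?V0 = "test_functions (cyl \<Omega>) \<inter> L12_weighted (cyl \<Omega>) w"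
  show "add ?H u v \<in> elems ?H" if "u \<in> elems ?H" "v \<in> elems ?H" for u v
    using that by (simp add: grad_space_def test_functions_base_add[OF \<Omega>] L12_weighted_add[OF U w])
  show "scale ?H c u \<in> elems ?H" if "u \<in> elems ?H" for u c
    using that by (simp add: grad_space_def test_functions_base_scale[OF \<Omega>] L12_weighted_scale[OF U w])
  show "ip ?H u v = ip ?H v u" for u v
    by (simp add: grad_space_def grad_inner_commute[OF U w, of u v])
  show "ip ?H (add ?H u v) z = ip ?H u z + ip ?H v z"
    if "u \<in> elems ?H" "v \<in> elems ?H" "z \<in> elems ?H" for u v z
    using that by (simp add: grad_space_def grad_inner_add_left[OF U w])
  show "ip ?H (scale ?H c u) z = c * ip ?H u z" if "u \<in> elems ?H" "z \<in> elems ?H" for u z c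
    using that by (simp add: grad_space_def grad_inner_scale_left[OF U w])
  show "0 \<le> ip ?H u u" for u
    by (simp add: grad_space_def grad_inner_nonneg[OF U w])
  show "?V0 \<subseteq> elems ?H"
    using test_functions_subset_base[OF \<Omega>] by (auto simp: grad_space_def)
  show "?V0 \<noteq> {}"
    using zero_in_test_functions zero_in_L12_weighted by blast
  show "add ?H u v \<in> ?V0" if "u \<in> ?V0" "v \<in> ?V0" for u v
    using that by (simp add: grad_space_def test_functions_add[OF U] L12_weighted_add[OF U w])
  show "scale ?H c u \<in> ?V0" if "u \<in> ?V0" for u c
    using that by (simp add: grad_space_def test_functions_scale[OF U] L12_weighted_scale[OF U w])
qed

theorem proposition4p5:
  fixes \<Omega> :: "(real^'n) set" and s G :: "real^'n \<Rightarrow> real"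
  assumes "open \<Omega>" and "bounded \<Omega>" and "\<Omega> \<noteq> {}"
    and "s \<in> borel_measurable (lebesgue_on \<Omega>)"
    and "AE x in lebesgue_on \<Omega>. s x \<in> {0..1}"
    and "is_weight \<Omega> G"
    and "locally_integrable \<Omega> (\<lambda>x. inverse (G x))"
    and "\<And>c. c \<in> {0<..<1} \<Longrightarrow> (\<forall>x\<in>\<Omega>. s x = c) \<Longrightarrow>
           (\<forall>x\<in>\<Omega>. G x = 2 powr (2 * c - 1) * Gamma c / Gamma (1 - c))"
  shows "\<forall>v \<in> elems (X_space \<Omega> (cyl_weight s G)).
           \<exists>!l. l \<in> dual (X_space \<Omega> (cyl_weight s G)) \<and>
             (\<forall>\<psi> \<in> elems (L_0L \<Omega> (cyl_weight s G)).
                l (Tr \<Omega> (cyl_weight s G) \<psi>) =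
                  ip (L_0L \<Omega> (cyl_weight s G)) (S_min \<Omega> (cyl_weight s G) v) \<psi>)"
proof
  let ?w = "cyl_weight s G"
  fix v assume v: "v \<in> elems (X_space \<Omega> ?w)"
  interpret V: semi_ip_subspace "grad_space \<Omega> ?w (test_functions_base \<Omega>)"
    "test_functions (cyl \<Omega>) \<inter> L12_weighted (cyl \<Omega>) ?w"
    by (intro semi_ip_subspace_grad_space is_weight_cyl_weight assms)
  have L_0: "L_0 \<Omega> ?w = V.M" by (simp add: L_0_def grad_space_def)
  interpret P: ip_projection_space "L_0L \<Omega> ?w" "L_0 \<Omega> ?w"
    using V.ip_projection_space_completion by (simp add: L_0 L_0L_def)
  show "\<exists>!l. l \<in> dual (X_space \<Omega> ?w) \<and>
      (\<forall>\<psi> \<in> elems (L_0L \<Omega> ?w). l (Tr \<Omega> ?w \<psi>) = ip (L_0L \<Omega> ?w) (S_min \<Omega> ?w v) \<psi>)"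
    using P.unique_functional_of_minimiser v unfolding X_space_def Tr_def S_min_def by blast
qed

end
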